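(* For an integer $n>2$ let $\Sigma_{2n}$ be the (finite) set of all partitions of the even integers in the interval $(4,2n]$ into two odd prime parts, and equip $\Sigma_{2n}$ with the uniform probability measure $\mathbb{P}$ (each partition has probability $1/|\Sigma_{2n}|$). For a partition chosen at random, let $2X_n\in(4,2n]$ be the integer it partitions (its size). Then for every $0<u<1$, $$\lim_{n\to\infty}\mathbb{P}\left(\frac{X_n}{n}\le u\right)=u^2.$$
   Context: A partition of an integer $N$ into two odd prime parts is an unordered pair $\{p,q\}$ (repetition allowed) of odd primes with $p+q=N$; its size is $N$. *)

theory Defs
  imports "HOL-Probability.Probability" "HOL-Computational_Algebra.Primes" "HOL-Library.Multiset"
begin

text \<open>An unordered pair with repetition allowed is a multiset of size two; the size of the
  partition, i.e. the integer being partitioned, is the sum \<open>\<Sum>\<^sub># P\<close> of its parts.\<close>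

definition odd_prime_partitions :: "nat \<Rightarrow> nat multiset set" where
  "odd_prime_partitions N = {{#p, q#} | p q. prime p \<and> odd p \<and> prime q \<and> odd q \<and> p + q = N}"

definition Sigma_part :: "nat \<Rightarrow> nat multiset set" where
  "Sigma_part m = (\<Union>N \<in> {N \<in> {4<..m}. even N}. odd_prime_partitions N)"

definition half_size :: "nat multiset \<Rightarrow> real" where
  "half_size P = real (\<Sum>\<^sub># P) / 2"

lemma finite_odd_prime_partitions: "finite (odd_prime_partitions N)"
proof (rule finite_subset)
  show "odd_prime_partitions N \<subseteq> (\<lambda>(p, q). {#p, q#}) ` ({..N} \<times> {..N})"
    by (auto simp: odd_prime_partitions_def)
qed auto

text \<open>\<open>pmf_of_set\<close> is the uniform distribution only on finite nonempty sets; the next two facts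
  show that it is used properly on \<open>Sigma_part (2 * n)\<close> for \<open>n > 2\<close>.\<close>

lemma finite_Sigma_part: "finite (Sigma_part m)"
  by (auto simp: Sigma_part_def finite_odd_prime_partitions)

lemma Sigma_part_nonempty:
  assumes "n > 2"
  shows "Sigma_part (2 * n) \<noteq> {}"
proof -
  have "prime (3::nat)"
    by simp
  then have "{#3, 3#} \<in> odd_prime_partitions 6"
    unfolding odd_prime_partitions_def by fastforce
  moreover have "6 \<in> {N \<in> {4<..2 * n}. even N}"
    using assms by auto
  ultimately show ?thesis
    unfolding Sigma_part_def by blast
qed

end

theory Submission
  imports Defs "HOL-Complex_Analysis.Complex_Analysis" "HOL-Real_Asymp.Real_Asymp"
    "HOL-Number_Theory.Prime_Powers"
begin

text \<open>
  The number of ordered pairs of odd primes with sum at most \<open>M\<close> is \<open>\<Sum>\<^sub>p \<pi>(M - p)\<close>. If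
  \<open>\<pi>(y) ln M = y + o(M)\<close> uniformly for \<open>y \<le> M\<close>, inserting this twice shows that the count is
  asymptotic to \<open>M\<^sup>2 / (2 ln\<^sup>2 M)\<close>; passing to unordered pairs halves it up to \<open>O(M)\<close>, and the
  ratio of the counts for \<open>2un\<close> and \<open>2n\<close> tends to \<open>u\<^sup>2\<close>.

  The uniform estimate is the prime number theorem \<open>\<psi>(n) \<sim> n\<close>, proved by Newman's method: since
  \<open>\<psi>(n) = O(n)\<close>, the coefficients \<open>(\<psi>(n) - n) / n\<close> are bounded, and their Dirichlet series continues
  holomorphically to a neighbourhood of \<open>Re s \<ge> 1\<close> because \<open>\<zeta>\<close> has no zeros there. Newman's
  contour argument then gives convergence of \<open>\<Sum> (\<psi>(n) - n) / n\<^sup>2\<close>, which by monotonicity of \<open>\<psi>\<close>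
  forces \<open>\<psi>(n) \<sim> n\<close>.
\<close>

section \<open>Newman's Tauberian theorem\<close>

text \<open>Partial summation of \<open>mangoldt_series s - zeta_series s\<close> produces the
  weights \<open>n^(-s) - (n+1)^(-s)\<close>, while the Tauberian theorem wants a series with
  weights \<open>n^(-s-1)\<close>. The discrepancy \<open>s n^(-s-1) - (n^(-s) - (n+1)^(-s))\<close>
  is \<open>zeta_term n (s + 1)\<close>, the same Taylor remainder whose plain sum continues (s-1)
  zeta(s). So one estimate O(n^(-1-Re s)) serves both continuations, and no integral over psi
  occurs. Subtracting n from psi(n) corresponds to subtracting zeta from -zeta'/zeta: both have a
  simple pole with residue 1 at s = 1, and the poles cancel. The only other possible singularities
  on Re s = 1 come from zeros of zeta. Prime counts are scaled by ln M rather than ln y, with errors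
  measured against M. The estimate is then linear in y and survives for small y, so it can be summed
  over all y up to M. In the final ratio the logarithms cancel, because ln(2un) and ln(2n) differ by
  a bounded amount.\<close>

text \<open>The integral of \<open>1/z\<close> is evaluated with the primitives \<open>Ln z\<close> on \<open>p\<close> and \<open>Ln (-z)\<close> on \<open>q\<close>,
  which avoids winding numbers.\<close>

lemma Cauchy_formula_two_paths:
  assumes f: "f holomorphic_on S" and S: "open S" "convex S" "0 \<in> S" and R: "R > 0"
    and p: "valid_path p" "path_image p \<subseteq> S - \<real>\<^sub>\<le>\<^sub>0"
      "pathstart p = - \<i> * of_real R" "pathfinish p = \<i> * of_real R"
    and q: "valid_path q" "path_image q \<subseteq> S - \<real>\<^sub>\<ge>\<^sub>0"
      "pathstart q = \<i> * of_real R" "pathfinish q = - \<i> * of_real R"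
  shows "contour_integral p (\<lambda>z. f z / z) + contour_integral q (\<lambda>z. f z / z) = 2 * of_real pi * \<i> * f 0"
    and "(\<lambda>z. f z / z) contour_integrable_on p" and "(\<lambda>z. f z / z) contour_integrable_on q"
proof -
  \<comment> \<open>The difference quotient extends holomorphically over 0, so its integral over the
    closed path vanishes. What remains is \<open>f 0\<close> times the integral of
    \<open>1 / z\<close>, which is \<open>pi * \<i>\<close> on each of the two paths.\<close>
  define g where "g = (\<lambda>z. if z = 0 then deriv f 0 else (f z - f 0) / (z - 0))"
  have g: "g holomorphic_on S"
    unfolding g_def by (rule pole_lemma) (use f S in \<open>auto simp: interior_open\<close>)
  have "(g has_contour_integral 0) (p +++ q)"
    by (rule Cauchy_theorem_convex_simple[OF g]) (use S p q in \<open>auto simp: path_image_join\<close>)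
  then have gpq: "contour_integral p g + contour_integral q g = 0"
    by (metis contour_integral_join contour_integral_unique has_contour_integral_integrable
        contour_integrable_join p(1,4) q(1,3))
  have gp: "g contour_integrable_on p" and gq: "g contour_integrable_on q"
    using contour_integrable_holomorphic_simple[OF g S(1)] p q by auto
  have Ln_i: "Ln (\<i> * of_real R) = of_real (ln R) + \<i> * of_real pi / 2"
    using Ln_times_of_real[of R \<i>] R by (simp add: mult.commute Ln_of_real)
  have Ln_mi: "Ln (- \<i> * of_real R) = of_real (ln R) - \<i> * of_real pi / 2"
    using Ln_times_of_real[of R "- \<i>"] R by (simp add: mult.commute Ln_of_real)
  have "((\<lambda>z. 1 / z) has_contour_integral Ln (pathfinish p) - Ln (pathstart p)) p"
    by (rule contour_integral_primitive[where S = "- \<real>\<^sub>\<le>\<^sub>0"])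
       (use p in \<open>auto intro!: derivative_eq_intros simp: divide_simps\<close>)
  then have ip: "((\<lambda>z. 1 / z) has_contour_integral of_real pi * \<i>) p"
    using Ln_i Ln_mi by (simp add: p mult.commute)
  have nn: "z \<notin> \<real>\<^sub>\<ge>\<^sub>0 \<Longrightarrow> - z \<notin> \<real>\<^sub>\<le>\<^sub>0" for z :: complex
    by (auto simp: complex_nonneg_Reals_iff complex_nonpos_Reals_iff)
  have "((\<lambda>z. 1 / z) has_contour_integral Ln (- pathfinish q) - Ln (- pathstart q)) q"
    by (rule contour_integral_primitive[where S = "- \<real>\<^sub>\<ge>\<^sub>0"])
       (use q nn in \<open>auto intro!: derivative_eq_intros simp: divide_simps\<close>)
  then have iq: "((\<lambda>z. 1 / z) has_contour_integral of_real pi * \<i>) q"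
    using Ln_i Ln_mi by (simp add: q mult.commute)
  have "((\<lambda>z. g z + f 0 * (1 / z)) has_contour_integral contour_integral p g + f 0 * (of_real pi * \<i>)) p"
    by (intro has_contour_integral_add has_contour_integral_lmul ip has_contour_integral_integral gp)
  then have 1: "((\<lambda>z. f z / z) has_contour_integral contour_integral p g + f 0 * (of_real pi * \<i>)) p"
    by (rule has_contour_integral_eq) (use p in \<open>auto simp: g_def divide_simps\<close>)
  have "((\<lambda>z. g z + f 0 * (1 / z)) has_contour_integral contour_integral q g + f 0 * (of_real pi * \<i>)) q"
    by (intro has_contour_integral_add has_contour_integral_lmul iq has_contour_integral_integral gq)
  then have 2: "((\<lambda>z. f z / z) has_contour_integral contour_integral q g + f 0 * (of_real pi * \<i>)) q"
    by (rule has_contour_integral_eq) (use q in \<open>auto simp: g_def divide_simps\<close>)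
  show "contour_integral p (\<lambda>z. f z / z) + contour_integral q (\<lambda>z. f z / z) = 2 * of_real pi * \<i> * f 0"
    using gpq by (simp add: contour_integral_unique[OF 1] contour_integral_unique[OF 2] algebra_simps eq_neg_iff_add_eq_0)
  show "(\<lambda>z. f z / z) contour_integrable_on p" "(\<lambda>z. f z / z) contour_integrable_on q"
    using 1 2 by (auto simp: contour_integrable_on_def)
qed

section \<open>Power sums and decay along segments\<close>

text \<open>By the mean value theorem each term is at most a difference of consecutive values of
  \<open>n powr (- x) / x\<close>, and these differences telescope. The factor \<open>1 / x\<close>
  is the one that the Newman kernel cancels.\<close>

lemma sum_powr_tail_le:
  fixes x :: real
  assumes x: "x > 0" and N: "N \<ge> 1"
  shows "summable (\<lambda>n. real (n + Suc N) powr (- 1 - x))"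
    and "(\<Sum>n. real (n + Suc N) powr (- 1 - x)) \<le> real N powr (- x) / x"
proof -
  define h where "h = (\<lambda>n. real (n + N) powr (- x) / x)"
  have le: "real (n + Suc N) powr (- 1 - x) \<le> h n - h (Suc n)" for n
  proof -
    have "\<exists>z>real (n+N). z < real (n + Suc N) \<and> real (n + Suc N) powr (-x) - real (n+N) powr (-x) = (real (n + Suc N) - real (n+N)) * (- x * z powr (- x - 1))"
      by (rule MVT2) (use N in \<open>auto intro!: derivative_eq_intros simp: powr_diff\<close>)
    then obtain z where z: "z > real (n+N)" "z < real (n + Suc N)"
      "real (n + Suc N) powr (-x) - real (n+N) powr (-x) = - x * z powr (- x - 1)" by auto
    have "real (n + Suc N) powr (-1 - x) \<le> z powr (-1 - x)"
      by (rule powr_mono2') (use x z N in auto)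
    also have "z powr (-1-x) = h n - h (Suc n)"
      using z(3) x minus_diff_commute[of x 1] by (simp add: h_def field_simps)
    finally show ?thesis .
  qed
  have "h \<longlonglongrightarrow> 0" unfolding h_def using x by real_asymp
  then have s: "(\<lambda>n. h n - h (Suc n)) sums h 0"
    using telescope_sums'[of h 0] by simp
  show 1: "summable (\<lambda>n. real (n + Suc N) powr (- 1 - x))"
    by (rule summable_comparison_test'[OF sums_summable[OF s], of 0]) (use le in auto)
  have "(\<Sum>n. real (n + Suc N) powr (- 1 - x)) \<le> (\<Sum>n. h n - h (Suc n))"
    by (rule suminf_le[OF le 1 sums_summable[OF s]])
  also have "\<dots> = h 0" using s by (rule sums_unique[symmetric])
  finally show "(\<Sum>n. real (n + Suc N) powr (- 1 - x)) \<le> real N powr (- x) / x"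
    by (simp add: h_def)
qed

text \<open>Comparison with the integral of \<open>t powr (a - 1)\<close>. For \<open>a < 1\<close>
  the integrand decreases and the first summand alone suffices; for \<open>a >= 1\<close> it
  increases, and the second summand pays for the last term.\<close>

lemma sum_powr_le:
  fixes a :: real
  assumes a: "a > 0"
  shows "(\<Sum>n=1..N. real n powr (a - 1)) \<le> real N powr a / a + real N powr (a - 1)"
proof (cases "N = 0")
  case False
  have mvt: "\<exists>z>real n. z < real (Suc n) \<and> real (Suc n) powr a / a - real n powr a / a = z powr (a - 1)" if "n \<ge> 1" for n
  proof -
    have "\<exists>z>real n. z < real (Suc n) \<and> real (Suc n) powr a / a - real n powr a / a = (real (Suc n) - real n) * z powr (a - 1)"
      by (rule MVT2) (use that a in \<open>auto intro!: derivative_eq_intros simp: powr_diff\<close>)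
    then show ?thesis by auto
  qed
  have "N \<ge> 1" using False by simp
  then show ?thesis
  proof (cases "a \<ge> 1")
    case True
    from \<open>N \<ge> 1\<close> show ?thesis
    proof (induction N rule: dec_induct)
      case (step n)
      obtain z where z: "z > real n" "real (Suc n) powr a / a - real n powr a / a = z powr (a - 1)" using mvt[of n] step by auto
      have "real n powr (a-1) \<le> z powr (a-1)" by (rule powr_mono2) (use z True in auto)
      then show ?case using step z by simp
    qed (use a in simp)
  next
    case a1: False
    from \<open>N \<ge> 1\<close> have "(\<Sum>n=1..N. real n powr (a - 1)) \<le> real N powr a / a"
    proof (induction N rule: dec_induct)
      case (step n)
      obtain z where z: "z > real n" "z < real (Suc n)" "real (Suc n) powr a / a - real n powr a / a = z powr (a - 1)" using mvt[of n] step by auto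
      have "real (Suc n) powr (a-1) \<le> z powr (a-1)" by (rule powr_mono2') (use z a1 in auto)
      then show ?case using step z by simp
    qed (use a a1 in simp)
    then show ?thesis by (smt (verit) powr_ge_zero)
  qed
qed auto

text \<open>At parameter \<open>t\<close> the exponential has modulus
  \<open>exp (t * Re b * ln N)\<close>. There is no decay at the end point \<open>a\<close>, but the
  integral over \<open>t\<close> is at most \<open>1 / (- Re b * ln N)\<close>, so an explicit bound
  replaces dominated convergence.\<close>

lemma contour_integral_linepath_exp_ln_tendsto_0:
  fixes F :: "complex \<Rightarrow> complex"
  assumes F: "continuous_on (closed_segment a b) F" and a: "Re a = 0" and b: "Re b < 0"
  shows "(\<lambda>N. contour_integral (linepath a b) (\<lambda>z. F z * exp (z * of_real (ln (real N))))) \<longlonglongrightarrow> 0"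
proof -
  have "compact (F ` closed_segment a b)"
    by (intro compact_continuous_image F) auto
  then obtain M where M: "\<And>z. z \<in> closed_segment a b \<Longrightarrow> norm (F z) \<le> M"
    by (meson compact_imp_bounded bounded_iff imageI)
  have M0: "M \<ge> 0" using M[of a] norm_ge_zero[of "F a"] by (simp del: norm_ge_zero)
  define K where "K = M * norm (b - a)"
  have bound: "norm (contour_integral (linepath a b) (\<lambda>z. F z * exp (z * of_real (ln (real N))))) \<le> K / (- Re b * ln (real N))"
    if N: "N \<ge> 2" for N
  proof -
    define l where "l = ln (real N)"
    have l: "l > 0" unfolding l_def using N by simp
    let ?f = "\<lambda>z. F z * exp (z * of_real l)"
    have "?f contour_integrable_on linepath a b"
      by (intro contour_integrable_continuous_linepath continuous_intros F)
    then have i: "((\<lambda>t. ?f (linepath a b t) * (b - a)) has_integral contour_integral (linepath a b) ?f) {0..1}"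
      by (rule has_contour_integral_linepath[THEN iffD1, OF has_contour_integral_integral])
    have "((\<lambda>t. K * exp (t * (Re b * l))) has_integral (K * exp (1 * (Re b * l)) / (Re b * l) - K * exp (0 * (Re b * l)) / (Re b * l))) {0..1}"
      by (rule fundamental_theorem_of_calculus)
         (use b l in \<open>auto intro!: derivative_eq_intros simp: has_real_derivative_iff_has_vector_derivative [symmetric]\<close>)
    then have j: "((\<lambda>t. K * exp (t * (Re b * l))) has_integral (K * (1 - exp (Re b * l)) / (- Re b * l))) {0..1}"
      by (simp add: right_diff_distrib diff_divide_distrib)
    have "norm (integral {0..1} (\<lambda>t. ?f (linepath a b t) * (b - a))) \<le> integral {0..1} (\<lambda>t. K * exp (t * (Re b * l)))"
    proof (rule integral_norm_bound_integral)
      fix t :: real assume t: "t \<in> {0..1}"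
      have "norm (F (linepath a b t)) \<le> M"
        by (rule M) (use t in \<open>auto simp: linepath_in_path\<close>)
      moreover have "Re (linepath a b t) = t * Re b"
        using a by (simp add: linepath_def)
      ultimately have "norm (?f (linepath a b t) * (b - a)) \<le> M * exp (t * Re b * l) * norm (b - a)"
        by (simp add: norm_mult mult_right_mono)
      then show "norm (?f (linepath a b t) * (b - a)) \<le> K * exp (t * (Re b * l))"
        by (simp add: K_def mult_ac)
    qed (use i j in \<open>auto simp: integrable_on_def\<close>)
    then have "norm (contour_integral (linepath a b) ?f) \<le> K * (1 - exp (Re b * l)) / (- Re b * l)"
      unfolding integral_unique[OF i] integral_unique[OF j] .
    also have "\<dots> \<le> K * 1 / (- Re b * l)"
      by (intro divide_right_mono mult_left_mono) (use M0 b l in \<open>auto simp: K_def mult_nonpos_nonneg\<close>)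
    finally show ?thesis by (simp add: l_def)
  qed
  have "(\<lambda>N. K / (- Re b * ln (real N))) \<longlonglongrightarrow> 0" using b by real_asymp
  then show ?thesis
    by (rule Lim_null_comparison[rotated]) (rule eventually_mono[OF eventually_ge_at_top[of 2]], erule bound)
qed

lemma norm_of_nat_powr: "norm (of_nat n powr s :: complex) = real n powr Re s"
  using norm_powr_real_powr[of "of_nat n" s] by simp

text \<open>On the circle \<open>1 / z = cnj z / R^2\<close>, so the kernel equals
  \<open>(cnj z + z) / R^2\<close>, which is real.\<close>

lemma norm_newman_kernel:
  assumes z: "norm z = R" and R: "R > 0"
  shows "norm ((1 + z\<^sup>2 / of_real (R\<^sup>2)) / z) = 2 * \<bar>Re z\<bar> / R\<^sup>2"
proof -
  have zz: "z * cnj z = of_real (R\<^sup>2)" using z complex_norm_square[of z] by simp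
  have "z \<noteq> 0" using z R by auto
  then have "(1 + z\<^sup>2 / of_real (R\<^sup>2)) / z = (cnj z + z) / of_real (R\<^sup>2)"
    using R zz by (simp add: field_simps power2_eq_square)
  also have "cnj z + z = of_real (2 * Re z)" by (simp add: complex_eq_iff)
  finally show ?thesis by (simp add: norm_divide abs_mult norm_power)
qed

text \<open>
  The integrand is taken along the right half of the circle \<open>|z| = R\<close>, closed up for \<open>f\<close> by the
  polygon through \<open>-\<delta>\<close>, where \<open>N\<^sup>z\<close> decays, and for the partial sum by the left half circle.
  On both half circles the factor \<open>(1 + z\<^sup>2/R\<^sup>2) / z = 2 Re z / R\<^sup>2\<close> cancels the \<open>1 / |Re z|\<close> in the
  bounds for the tail and for the partial sum, so that they contribute only \<open>O(1/R)\<close>.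
\<close>

theorem newman_tauberian:
  fixes a :: "nat \<Rightarrow> complex"
  assumes a: "\<And>n. norm (a n) \<le> B"
    and U: "open U" "{z. Re z \<ge> 0} \<subseteq> U" and f: "f holomorphic_on U"
    and sums: "\<And>z. Re z > 0 \<Longrightarrow> (\<lambda>n. a n * of_nat n powr (- 1 - z)) sums f z"
  shows "(\<lambda>N. \<Sum>n=1..N. a n / of_nat n) \<longlonglongrightarrow> f 0"
proof (rule LIMSEQ_I)
  fix e :: real assume e: "e > 0"
  have B: "B \<ge> 0" using a[of 0] norm_ge_zero order_trans by blast
  \<comment> \<open>The half circles contribute \<open>6 * B * pi / R\<close> in total, which this
    choice makes at most three quarters of \<open>2 * pi * e\<close>. Using \<open>B + 1\<close>
    keeps \<open>R\<close> positive when \<open>B = 0\<close>.\<close>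
  define R where "R = 4 * (B + 1) / e"
  have R: "R > 0" unfolding R_def using B e by simp
  define s where "s = (\<lambda>N z. \<Sum>n=1..N. a n * of_nat n powr (- 1 - z))"
  have "compact (closed_segment (- \<i> * of_real R) (\<i> * of_real R))" by simp
  moreover have seg: "z \<in> closed_segment (- \<i> * of_real R) (\<i> * of_real R) \<longleftrightarrow> Re z = 0 \<and> \<bar>Im z\<bar> \<le> R" for z
  proof
    assume "z \<in> closed_segment (- \<i> * of_real R) (\<i> * of_real R)"
    then obtain u where u: "0 \<le> u" "u \<le> 1" "z = (1 - u) *\<^sub>R (- \<i> * of_real R) + u *\<^sub>R (\<i> * of_real R)"
      by (auto simp: in_segment)
    have "Im z = (2 * u - 1) * R" unfolding u(3) by (simp add: algebra_simps)
    moreover have "\<bar>2 * u - 1\<bar> * R \<le> 1 * R" by (intro mult_right_mono) (use u R in auto)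
    ultimately show "Re z = 0 \<and> \<bar>Im z\<bar> \<le> R" using u R by (simp add: abs_mult)
  next
    assume z: "Re z = 0 \<and> \<bar>Im z\<bar> \<le> R"
    define u where "u = (Im z + R) / (2 * R)"
    have "0 \<le> u" "u \<le> 1" using z R by (auto simp: u_def field_simps)
    moreover have "z = (1 - u) *\<^sub>R (- \<i> * of_real R) + u *\<^sub>R (\<i> * of_real R)"
      using z R by (auto simp: complex_eq_iff u_def field_simps)
    ultimately show "z \<in> closed_segment (- \<i> * of_real R) (\<i> * of_real R)" unfolding in_segment by blast
  qed
  ultimately obtain d where d: "d > 0" "\<And>z. z \<in> closed_segment (- \<i> * of_real R) (\<i> * of_real R) \<Longrightarrow> ball z d \<subseteq> U"
    using compact_subset_open_imp_ball_epsilon_subset[of "closed_segment (- \<i> * of_real R) (\<i> * of_real R)" U] U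
    by (smt (verit, best) UN_subset_iff mem_Collect_eq subset_iff)
  \<comment> \<open>A convex neighbourhood of the right half disc inside \<open>U\<close>. It can
    cross the imaginary axis by a fixed amount, because compactness of the segment from
    \<open>- \<i> R\<close> to \<open>\<i> R\<close> gives one radius \<open>d\<close> for all its
    points.\<close>
  define S where "S = {z. Re z > - d / 2 \<and> \<bar>Im z\<bar> < R + d / 2}"
  have SU: "S \<subseteq> U"
  proof
    fix z assume z: "z \<in> S"
    show "z \<in> U"
    proof (cases "Re z \<ge> 0")
      case False
      \<comment> \<open>Clamping \<open>Im z\<close> to [-R, R] gives the nearest point of the
        segment; both coordinates then differ by less than \<open>d / 2\<close>.\<close>
      define y where "y = max (- R) (min R (Im z))"
      have "norm (z - Complex 0 y) \<le> \<bar>Re z\<bar> + \<bar>Im z - y\<bar>"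
        using cmod_le[of "z - Complex 0 y"] by simp
      also have "\<dots> < d" using z False R d by (auto simp: S_def y_def max_def min_def)
      finally have "z \<in> ball (Complex 0 y) d" by (simp add: dist_norm norm_minus_commute)
      moreover have "Complex 0 y \<in> closed_segment (- \<i> * of_real R) (\<i> * of_real R)"
        unfolding seg using R by (auto simp: y_def)
      ultimately show ?thesis using d(2) by blast
    qed (use U in auto)
  qed
  have S: "open S" "convex S" "0 \<in> S"
  proof -
    have S_eq: "S = {z. Re z > - d / 2} \<inter> {z. Im z < R + d / 2} \<inter> {z. Im z > - (R + d / 2)}"
      unfolding S_def by auto
    show "open S" unfolding S_eq by (intro open_Int open_halfspace_Re_gt open_halfspace_Im_lt open_halfspace_Im_gt)
    show "convex S" unfolding S_eq by (intro convex_Int convex_halfspace_Re_gt convex_halfspace_Im_lt convex_halfspace_Im_gt)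
    show "0 \<in> S" using d R by (auto simp: S_def)
  qed
  define p where "p = part_circlepath 0 R (- pi / 2) (pi / 2)"
  define p' where "p' = part_circlepath 0 R (pi / 2) (3 * pi / 2)"
  define b where "b = complex_of_real (- d / 4)"
  define q where "q = linepath (\<i> * of_real R) b +++ linepath b (- \<i> * of_real R)"
  have p: "valid_path p" "pathstart p = - \<i> * of_real R" "pathfinish p = \<i> * of_real R"
    by (auto simp: p_def complex_eq_iff Re_exp Im_exp)
  have p': "valid_path p'" "pathstart p' = \<i> * of_real R" "pathfinish p' = - \<i> * of_real R"
    using cos_3over2_pi sin_3over2_pi by (auto simp: p'_def complex_eq_iff Re_exp Im_exp mult_ac)
  have q: "valid_path q" "pathstart q = \<i> * of_real R" "pathfinish q = - \<i> * of_real R"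
    by (auto simp: q_def)
  have ends: "z = \<i> * of_real R \<or> z = - \<i> * of_real R" if "norm z = R" "Re z = 0" for z
    using that R by (auto simp: cmod_def complex_eq_iff real_sqrt_abs abs_if split: if_splits)
  have pim: "norm z = R \<and> Re z \<ge> 0" if z: "z \<in> path_image p" for z
  proof -
    obtain x where x: "z = of_real R * cis x" "x \<in> {- pi / 2..pi / 2}"
      using z unfolding p_def path_image_part_circlepath' by (fastforce simp: closed_segment_eq_real_ivl1)
    have "cos x \<ge> 0" by (rule cos_ge_zero) (use x in auto)
    then show ?thesis using R x by (auto simp: norm_mult)
  qed
  have p'im: "norm z = R \<and> Re z \<le> 0" if z: "z \<in> path_image p'" for z
  proof -
    obtain x where x: "z = of_real R * cis x" "x \<in> {pi / 2..3 * pi / 2}"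
      using z unfolding p'_def path_image_part_circlepath' by (fastforce simp: closed_segment_eq_real_ivl1)
    have "cos (x - pi) \<ge> 0" by (rule cos_ge_zero) (use x in auto)
    then have "cos x \<le> 0" by (simp add: cos_diff)
    then show ?thesis using R x by (auto simp: norm_mult mult_nonneg_nonpos)
  qed
  have seg_im: "z \<in> S \<and> z \<notin> \<real>\<^sub>\<ge>\<^sub>0" if z: "z \<in> closed_segment c b" "c = \<i> * of_real R \<or> c = - \<i> * of_real R" for z c
  proof -
    obtain u where u: "0 \<le> u" "u \<le> 1" "z = (1 - u) *\<^sub>R c + u *\<^sub>R b"
      using z by (auto simp: in_segment)
    have Re: "Re z = - u * d / 4" using u(3) that(2) by (auto simp: b_def)
    have Im: "\<bar>Im z\<bar> = (1 - u) * R" using u that(2) R by (auto simp: b_def abs_mult)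
    have "(1 - u) * R \<le> 1 * R" using u R by (intro mult_right_mono) auto
    moreover have "u * d \<le> 1 * d" using u d by (intro mult_right_mono) auto
    ultimately have "z \<in> S" using d(1) by (auto simp: S_def Re Im)
    moreover have "z \<notin> \<real>\<^sub>\<ge>\<^sub>0"
    proof
      assume "z \<in> \<real>\<^sub>\<ge>\<^sub>0"
      then have "Re z \<ge> 0" "Im z = 0" by (auto simp: complex_nonneg_Reals_iff)
      then have "u * d \<le> 0" "(1 - u) * R = 0" using Re Im by auto
      then show False using d R by auto
    qed
    ultimately show ?thesis by blast
  qed
  have qim: "path_image q \<subseteq> S - \<real>\<^sub>\<ge>\<^sub>0"
    using seg_im by (auto simp: q_def path_image_join closed_segment_commute)
  define k where "k = (\<lambda>z. 1 + z\<^sup>2 / complex_of_real (R\<^sup>2))"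
  define E where "E = (\<lambda>N (z::complex). exp (z * of_real (ln (real N))))"
  have pS: "path_image p \<subseteq> S - \<real>\<^sub>\<le>\<^sub>0"
  proof
    fix z assume "z \<in> path_image p"
    then have z: "norm z = R" "Re z \<ge> 0" using pim by auto
    have "z \<in> S" using z d(1) abs_Im_le_cmod[of z] by (auto simp: S_def)
    moreover have "z \<notin> \<real>\<^sub>\<le>\<^sub>0"
    proof
      assume "z \<in> \<real>\<^sub>\<le>\<^sub>0"
      then have "z = 0" using z(2) by (auto simp: complex_nonpos_Reals_iff complex_eq_iff)
      then show False using z(1) R by simp
    qed
    ultimately show "z \<in> S - \<real>\<^sub>\<le>\<^sub>0" by simp
  qed
  have p'S: "path_image p' \<subseteq> UNIV - \<real>\<^sub>\<ge>\<^sub>0"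
  proof
    fix z assume "z \<in> path_image p'"
    then have z: "norm z = R" "Re z \<le> 0" using p'im by auto
    have "z \<notin> \<real>\<^sub>\<ge>\<^sub>0"
    proof
      assume "z \<in> \<real>\<^sub>\<ge>\<^sub>0"
      then have "z = 0" using z(2) by (auto simp: complex_nonneg_Reals_iff complex_eq_iff)
      then show False using z(1) R by simp
    qed
    then show "z \<in> UNIV - \<real>\<^sub>\<ge>\<^sub>0" by simp
  qed
  have holk: "k holomorphic_on A" for A unfolding k_def using R by (intro holomorphic_intros) auto
  have holE: "E N holomorphic_on A" for A N unfolding E_def by (intro holomorphic_intros)
  have hols: "s N holomorphic_on A" for A N unfolding s_def by (auto intro!: holomorphic_intros)
  have normE: "norm (E N z) = real N powr Re z" if "N \<ge> 1" for N z
    using that by (simp add: E_def powr_def mult.commute)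
  have normk: "norm (k z / z) = 2 * \<bar>Re z\<bar> / R\<^sup>2" if "norm z = R" for z
    using norm_newman_kernel[of z R] that R by (simp add: k_def)
  \<comment> \<open>Cauchy's formula for \<open>f\<close> uses \<open>p\<close> and
    \<open>q\<close>; for the entire function \<open>s N\<close> it uses \<open>p\<close> and
    \<open>p'\<close>. Subtracting them leaves \<open>f - s N\<close>, the tail of the series, on
    \<open>p\<close>, only \<open>f\<close> on \<open>q\<close>, and only \<open>s N\<close> on
    \<open>p'\<close>.\<close>
  have main: "2 * pi * norm (f 0 - s N 0) \<le> 2 * B / R\<^sup>2 * R * pi + norm (contour_integral q (\<lambda>z. f z * k z / z * E N z)) + 4 * B / R\<^sup>2 * R * pi"
    if N: "N \<ge> 1" "real N \<ge> R" for N
  proof -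
    have 1: "contour_integral p (\<lambda>z. (f z * k z * E N z) / z) + contour_integral q (\<lambda>z. (f z * k z * E N z) / z) = 2 * of_real pi * \<i> * (f 0 * k 0 * E N 0)" (is ?th1)
            "(\<lambda>z. (f z * k z * E N z) / z) contour_integrable_on p" (is ?th2)
    proof -
      have "(\<lambda>z. f z * k z * E N z) holomorphic_on S"
        by (intro holomorphic_on_mult holE holk holomorphic_on_subset[OF f SU])
      note * = Cauchy_formula_two_paths[OF this S R p(1) pS p(2,3) q(1) qim q(2,3)]
      show ?th1 ?th2 using * by auto
    qed
    have 2: "contour_integral p (\<lambda>z. (s N z * k z * E N z) / z) + contour_integral p' (\<lambda>z. (s N z * k z * E N z) / z) = 2 * of_real pi * \<i> * (s N 0 * k 0 * E N 0)" (is ?th1)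
            "(\<lambda>z. (s N z * k z * E N z) / z) contour_integrable_on p" (is ?th2)
            "(\<lambda>z. (s N z * k z * E N z) / z) contour_integrable_on p'" (is ?th3)
    proof -
      have "(\<lambda>z. s N z * k z * E N z) holomorphic_on UNIV"
        by (intro holomorphic_on_mult holE holk hols)
      note * = Cauchy_formula_two_paths[OF this open_UNIV convex_UNIV UNIV_I R p(1) _ p(2,3) p'(1) p'S p'(2,3)]
      show ?th1 ?th2 ?th3 using * pS by auto
    qed
    let ?g = "\<lambda>z. (f z * k z * E N z) / z - (s N z * k z * E N z) / z"
    have "norm (contour_integral p ?g) \<le> 2 * B / R\<^sup>2 * R * (pi / 2 - (- pi / 2))"
      unfolding p_def
    \<comment> \<open>The end points are excluded because \<open>Re z = 0\<close> there: the series
      is not assumed to converge and the tail bound divides by \<open>Re z\<close>.\<close>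
    proof (rule contour_integral_bound_part_circlepath_strong[where k = "{\<i> * of_real R, - \<i> * of_real R}"])
      show "?g contour_integrable_on part_circlepath 0 R (- pi / 2) (pi / 2)"
        using 1 2 contour_integrable_diff p_def by auto
      fix z assume "z \<in> path_image (part_circlepath 0 R (- pi / 2) (pi / 2)) - {\<i> * of_real R, - \<i> * of_real R}"
      then have z: "norm z = R" "Re z > 0"
        using pim[of z] ends[of z] by (auto simp: p_def less_le)
      have "(\<lambda>n. a (n + Suc N) * of_nat (n + Suc N) powr (- 1 - z)) sums (f z - (\<Sum>n<Suc N. a n * of_nat n powr (- 1 - z)))"
        using sums[OF z(2)] by (rule sums_split_initial_segment)
      \<comment> \<open>Index 0 contributes nothing, since \<open>0 powr w = 0\<close>.\<close>
      also have "(\<Sum>n<Suc N. a n * of_nat n powr (- 1 - z)) = s N z"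
        unfolding s_def lessThan_Suc_atMost by (intro sum.mono_neutral_right) (auto simp: Suc_le_eq)
      finally have *: "(\<lambda>n. a (n + Suc N) * of_nat (n + Suc N) powr (- 1 - z)) sums (f z - s N z)" .
      have le: "norm (a (n + Suc N) * of_nat (n + Suc N) powr (- 1 - z)) \<le> B * real (n + Suc N) powr (- 1 - Re z)" for n
        unfolding norm_mult norm_of_nat_powr by (intro mult_mono) (use a B in auto)
      have "norm (f z - s N z) \<le> (\<Sum>n. B * real (n + Suc N) powr (- 1 - Re z))"
        unfolding sums_unique[OF *]
        by (rule norm_suminf_le[OF le]) (intro summable_mult sum_powr_tail_le z N)
      also have "\<dots> = B * (\<Sum>n. real (n + Suc N) powr (- 1 - Re z))"
        by (rule suminf_mult) (intro sum_powr_tail_le z N)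
      also have "\<dots> \<le> B * (real N powr (- Re z) / Re z)"
        by (intro mult_left_mono sum_powr_tail_le z N B)
      finally have fs: "norm (f z - s N z) \<le> B * (real N powr (- Re z) / Re z)" .
      have "?g z = (f z - s N z) * (k z / z) * E N z" by (simp add: diff_divide_distrib algebra_simps)
      also have "norm \<dots> = norm (f z - s N z) * (2 * Re z / R\<^sup>2) * real N powr Re z"
        unfolding norm_mult using normk[OF z(1)] normE[OF N(1), of z] z by simp
      also have "\<dots> \<le> (B * (real N powr (- Re z) / Re z)) * (2 * Re z / R\<^sup>2) * real N powr Re z"
        by (intro mult_right_mono fs) (use z in auto)
      also have "\<dots> = 2 * B / R\<^sup>2 * (real N powr (- Re z) * real N powr Re z)"
        using z R by (simp add: field_simps)
      also have "real N powr (- Re z) * real N powr Re z = 1"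
        using N by (simp flip: powr_add)
      finally show "norm (?g z) \<le> 2 * B / R\<^sup>2" by simp
    qed (use B R in auto)
    then have I1: "norm (contour_integral p ?g) \<le> 2 * B / R\<^sup>2 * R * pi" by simp
    have "norm (contour_integral p' (\<lambda>z. (s N z * k z * E N z) / z)) \<le> 4 * B / R\<^sup>2 * R * (3 * pi / 2 - pi / 2)"
      unfolding p'_def
    proof (rule contour_integral_bound_part_circlepath_strong[where k = "{\<i> * of_real R, - \<i> * of_real R}"])
      fix z assume "z \<in> path_image (part_circlepath 0 R (pi / 2) (3 * pi / 2)) - {\<i> * of_real R, - \<i> * of_real R}"
      then have z: "norm z = R" "Re z < 0"
        using p'im[of z] ends[of z] by (auto simp: p'_def less_le)
      define x where "x = - Re z"
      have x: "x > 0" "x \<le> R" using z abs_Re_le_cmod[of z] by (auto simp: x_def)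
      have Rez: "Re (- 1 - z) = x - 1" by (simp add: x_def)
      have "norm (s N z) \<le> (\<Sum>n=1..N. B * real n powr (x - 1))"
        unfolding s_def
      proof (rule sum_norm_le)
        fix n show "norm (a n * of_nat n powr (- 1 - z)) \<le> B * real n powr (x - 1)"
          unfolding norm_mult norm_of_nat_powr Rez by (intro mult_mono) (use a B in auto)
      qed
      also have "\<dots> \<le> B * (real N powr x / x + real N powr (x - 1))"
        unfolding sum_distrib_left[symmetric] by (intro mult_left_mono sum_powr_le x B)
      also have "real N powr (x - 1) = real N powr x / real N" using N by (simp add: powr_diff)
      \<comment> \<open>Here \<open>x <= R <= N\<close> enters; it absorbs the boundary term of the
        power sum and doubles the constant.\<close>
      also have "real N powr x / real N \<le> real N powr x / x"
        by (intro divide_left_mono) (use x N in auto)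
      also have "B * (real N powr x / x + real N powr x / x) = 2 * B * real N powr x / x" by simp
      finally have sN: "norm (s N z) \<le> 2 * B * real N powr x / x" using B by (simp add: mult_left_mono)
      have "(s N z * k z * E N z) / z = s N z * (k z / z) * E N z" by simp
      also have "norm \<dots> = norm (s N z) * (2 * x / R\<^sup>2) * real N powr (- x)"
        unfolding norm_mult using normk[OF z(1)] normE[OF N(1), of z] z by (simp add: x_def)
      also have "\<dots> \<le> (2 * B * real N powr x / x) * (2 * x / R\<^sup>2) * real N powr (- x)"
        by (intro mult_right_mono sN) (use x in auto)
      also have "\<dots> = 4 * B / R\<^sup>2 * (real N powr x * real N powr (- x))"
        using x R by (simp add: field_simps)
      also have "real N powr x * real N powr (- x) = 1"
        using N by (simp flip: powr_add)
      finally show "norm ((s N z * k z * E N z) / z) \<le> 4 * B / R\<^sup>2" by simp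
    qed (use B R 2 in \<open>auto simp: p'_def\<close>)
    then have I2: "norm (contour_integral p' (\<lambda>z. (s N z * k z * E N z) / z)) \<le> 4 * B / R\<^sup>2 * R * pi" by simp
    let ?I1 = "contour_integral p ?g" and ?I2 = "contour_integral q (\<lambda>z. f z * k z / z * E N z)"
      and ?I3 = "contour_integral p' (\<lambda>z. (s N z * k z * E N z) / z)"
    have alg: "c * (x - y) = i + i2 - i3" if "i1 + i2 = c * x" "i1' + i3 = c * y" "i = i1 - i1'"
      for c x y i i1 i1' i2 i3 :: complex
    proof -
      have "c * (x - y) = c * x - c * y" by (rule right_diff_distrib)
      also have "\<dots> = i + i2 - i3" unfolding that(1,2)[symmetric] that(3) by simp
      finally show ?thesis .
    qed
    have "2 * of_real pi * \<i> * (f 0 - s N 0) = ?I1 + ?I2 - ?I3"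
    proof (rule alg[OF _ _ contour_integral_diff[OF 1(2) 2(2)]])
      have "k 0 = 1" "E N 0 = 1" by (auto simp: k_def E_def)
      moreover have "(\<lambda>z. f z * k z / z * E N z) = (\<lambda>z. (f z * k z * E N z) / z)" by auto
      ultimately show "contour_integral p (\<lambda>z. (f z * k z * E N z) / z) + ?I2 = 2 * of_real pi * \<i> * f 0"
        "contour_integral p (\<lambda>z. (s N z * k z * E N z) / z) + ?I3 = 2 * of_real pi * \<i> * s N 0"
        using 1(1) 2(1) by (simp_all only: mult_1_right)
    qed
    then have "norm (2 * of_real pi * \<i> * (f 0 - s N 0)) \<le> norm (?I1 + ?I2) + norm ?I3"
      by (simp only: norm_triangle_ineq4)
    also have "norm (?I1 + ?I2) \<le> norm ?I1 + norm ?I2" by (rule norm_triangle_ineq)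
    also have "norm ?I1 + norm ?I2 + norm ?I3 \<le> 2 * B / R\<^sup>2 * R * pi + norm ?I2 + 4 * B / R\<^sup>2 * R * pi"
      by (intro add_mono I1 I2 order_refl)
    finally have "norm (2 * of_real pi * \<i> * (f 0 - s N 0)) \<le> 2 * B / R\<^sup>2 * R * pi + norm ?I2 + 4 * B / R\<^sup>2 * R * pi"
      by simp
    then show ?thesis by (simp add: norm_mult)
  qed
  have "(\<lambda>N. contour_integral q (\<lambda>z. f z * k z / z * E N z)) \<longlonglongrightarrow> 0"
  proof -
    define F where "F = (\<lambda>z. f z * k z / z)"
    have conF: "continuous_on (S - \<real>\<^sub>\<ge>\<^sub>0) F"
      unfolding F_def using holk holomorphic_on_subset[OF f SU]
      by (intro holomorphic_on_imp_continuous_on holomorphic_intros) (auto intro: holomorphic_on_subset)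
    have con: "continuous_on (closed_segment c b) F" if "c = \<i> * of_real R \<or> c = - \<i> * of_real R" for c
      by (rule continuous_on_subset[OF conF]) (use seg_im that in auto)
    have lim: "(\<lambda>N. contour_integral (linepath c b) (\<lambda>z. F z * E N z)) \<longlonglongrightarrow> 0" if "c = \<i> * of_real R \<or> c = - \<i> * of_real R" for c
      unfolding E_def by (rule contour_integral_linepath_exp_ln_tendsto_0[OF con]) (use that d in \<open>auto simp: b_def\<close>)
    \<comment> \<open>The second segment is reversed so that both start on the imaginary axis and
      end at \<open>b\<close>, as the decay lemma requires.\<close>
    have eq: "contour_integral q (\<lambda>z. F z * E N z) = contour_integral (linepath (\<i> * of_real R) b) (\<lambda>z. F z * E N z)
            - contour_integral (linepath (- \<i> * of_real R) b) (\<lambda>z. F z * E N z)" for N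
    proof -
      have "continuous_on (closed_segment c b) (\<lambda>z. F z * E N z)" if "c = \<i> * of_real R \<or> c = - \<i> * of_real R" for c
        by (intro continuous_intros con that holomorphic_on_imp_continuous_on holE)
      then have int: "(\<lambda>z. F z * E N z) contour_integrable_on linepath (\<i> * of_real R) b"
          "(\<lambda>z. F z * E N z) contour_integrable_on linepath b (- \<i> * of_real R)"
        and rev: "contour_integral (linepath (- \<i> * of_real R) b) (\<lambda>z. F z * E N z) = - contour_integral (linepath b (- \<i> * of_real R)) (\<lambda>z. F z * E N z)"
        by (auto intro!: contour_integrable_continuous_linepath contour_integral_reverse_linepath simp: closed_segment_commute[of b])
      show ?thesis unfolding q_def rev by (subst contour_integral_join[OF int]) auto
    qed
    have "(\<lambda>N. contour_integral q (\<lambda>z. F z * E N z)) \<longlonglongrightarrow> 0 - 0"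
      unfolding eq by (intro tendsto_diff lim) auto
    then show ?thesis by (simp add: F_def)
  qed
  then obtain N0 where N0: "\<And>N. N \<ge> N0 \<Longrightarrow> norm (contour_integral q (\<lambda>z. f z * k z / z * E N z)) < e / 4"
    using LIMSEQ_D[of _ 0 "e / 4"] e by auto
  have "norm (s N 0 - f 0) < e" if N: "N \<ge> max N0 (max 1 (nat \<lceil>R\<rceil>))" for N
  proof -
    have "2 * pi * norm (f 0 - s N 0) \<le> 6 * B / R * pi + e / 4"
      using main[of N] N0[of N] N R by (simp add: power2_eq_square nat_ceiling_le_eq)
    also have "6 * B / R * pi \<le> 2 * pi * (e * 3 / 4)"
      unfolding R_def using B e by (simp add: field_simps)
    finally have "2 * pi * norm (f 0 - s N 0) \<le> 2 * pi * (e * 3 / 4) + e / 4" by simp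
    also have "\<dots> < 2 * pi * (e * 3 / 4) + 2 * pi * (e / 4)"
      using mult_strict_right_mono[OF pi_gt3 e] e by (simp add: field_simps)
    also have "\<dots> = 2 * pi * e" by (simp add: algebra_simps)
    finally show ?thesis using pi_gt_zero by (simp add: norm_minus_commute)
  qed
  moreover have "s N 0 = (\<Sum>n=1..N. a n / of_nat n)" for N
    unfolding s_def by (intro sum.cong) (auto simp: powr_minus field_simps)
  ultimately show "\<exists>no. \<forall>N\<ge>no. norm ((\<Sum>n=1..N. a n / of_nat n) - f 0) < e"
    by (metis (no_types, lifting))
qed

section \<open>Dirichlet series and the zeta function\<close>

lemma of_nat_powr_has_field_derivative:
  "((\<lambda>s. of_nat n powr (- s) :: complex) has_field_derivative (- of_real (ln (real n)) * of_nat n powr (- s))) (at s)"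
proof (cases "n = 0")
  case False
  then show ?thesis unfolding powr_def
    by (auto intro!: derivative_eq_intros simp: Ln_of_nat)
qed auto

lemma holomorphic_on_of_nat_powr [holomorphic_intros]:
  "f holomorphic_on A \<Longrightarrow> (\<lambda>s. of_nat n powr f s :: complex) holomorphic_on A"
  by (cases "n = 0") (auto intro!: holomorphic_intros)

text \<open>Weierstrass M-test with a majorant near each point: the convergence is locally uniform,
  so the limit is holomorphic and may be differentiated termwise. The termwise derivative is what
  later produces the factors \<open>ln n\<close>.\<close>

lemma suminf_holomorphic_local:
  fixes f :: "nat \<Rightarrow> complex \<Rightarrow> complex"
  assumes S: "open S" and f: "\<And>n. f n holomorphic_on S"
    and bound: "\<And>x. x \<in> S \<Longrightarrow> \<exists>d h. d > 0 \<and> summable h \<and> (\<forall>n. h n \<ge> 0) \<and>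
      (\<forall>n\<ge>1. \<forall>y\<in>ball x d \<inter> S. norm (f n y) \<le> h n)"
  shows "(\<lambda>s. \<Sum>n. f n s) holomorphic_on S"
    and "x \<in> S \<Longrightarrow> summable (\<lambda>n. f n x)"
    and "x \<in> S \<Longrightarrow> (\<lambda>n. deriv (f n) x) sums deriv (\<lambda>s. \<Sum>n. f n s) x"
proof -
  have "\<exists>g g'. \<forall>x\<in>S. (\<lambda>n. f n x) sums g x \<and> (\<lambda>n. deriv (f n) x) sums g' x \<and> (g has_field_derivative g' x) (at x)"
  proof (rule series_and_derivative_comparison_complex[OF S])
    fix n x assume "x \<in> S"
    then show "(f n has_field_derivative deriv (f n) x) (at x)"
      using f S holomorphic_derivI by blast
  next
    fix x assume "x \<in> S"
    from bound[OF this] obtain d h where dh: "d > 0" "summable h" "\<And>n. h n \<ge> 0"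
      "\<And>n y. n \<ge> 1 \<Longrightarrow> y \<in> ball x d \<inter> S \<Longrightarrow> norm (f n y) \<le> h n" by blast
    have "\<forall>\<^sub>F n in sequentially. \<forall>y\<in>ball x d \<inter> S. norm (f n y) \<le> norm (complex_of_real (h n))"
      using eventually_ge_at_top[of 1] by eventually_elim (use dh in auto)
    with dh show "\<exists>d h. 0 < d \<and> summable h \<and> range h \<subseteq> \<real>\<^sub>\<ge>\<^sub>0 \<and>
        (\<forall>\<^sub>F n in sequentially. \<forall>y\<in>ball x d \<inter> S. norm (f n y) \<le> norm (h n :: complex))"
      by (intro exI[of _ d] exI[of _ "\<lambda>n. complex_of_real (h n)"]) (auto simp: summable_of_real)
  qed
  then obtain g g' where g: "\<And>x. x \<in> S \<Longrightarrow> (\<lambda>n. f n x) sums g x"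
    "\<And>x. x \<in> S \<Longrightarrow> (\<lambda>n. deriv (f n) x) sums g' x" "\<And>x. x \<in> S \<Longrightarrow> (g has_field_derivative g' x) (at x)" by blast
  have eq: "g x = (\<Sum>n. f n x)" if "x \<in> S" for x using g(1)[OF that] by (rule sums_unique)
  have der: "((\<lambda>s. \<Sum>n. f n s) has_field_derivative g' x) (at x)" if "x \<in> S" for x
    by (rule has_field_derivative_transform_within_open[OF g(3)[OF that] S that]) (use eq in auto)
  then show "(\<lambda>s. \<Sum>n. f n s) holomorphic_on S"
    using S holomorphic_on_open by blast
  show "summable (\<lambda>n. f n x)" if "x \<in> S" using g(1)[OF that] by (rule sums_summable)
  show "(\<lambda>n. deriv (f n) x) sums deriv (\<lambda>s. \<Sum>n. f n s) x" if "x \<in> S"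
    using g(2)[OF that] DERIV_imp_deriv[OF der[OF that]] by simp
qed

lemma summable_powr: "summable (\<lambda>n. real n powr e)" if "e < -1"
  using that by (simp add: summable_real_powr_iff)

lemma dirichlet_series:
  fixes c :: "nat \<Rightarrow> complex"
  assumes c: "\<forall>e>0. \<exists>K\<ge>0. \<forall>n\<ge>1. norm (c n) \<le> K * real n powr e"
  shows "Re s > 1 \<Longrightarrow> summable (\<lambda>n. norm (c n * of_nat n powr (- s)))"
    and "(\<lambda>s. \<Sum>n. c n * of_nat n powr (- s)) holomorphic_on {s. Re s > 1}"
    and "Re s > 1 \<Longrightarrow> (\<lambda>n. - of_real (ln (real n)) * (c n * of_nat n powr (- s))) sums
           deriv (\<lambda>s. \<Sum>n. c n * of_nat n powr (- s)) s"
proof -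
  have bnd: "\<exists>d h. d > 0 \<and> summable h \<and> (\<forall>n. h n \<ge> 0) \<and>
      (\<forall>n\<ge>1. \<forall>y\<in>ball x d \<inter> {s. Re s > 1}. norm (c n * of_nat n powr (- y)) \<le> h n)" if x: "Re x > 1" for x
  proof -
    \<comment> \<open>A third of the distance to the line Re s = 1: one \<open>d\<close> is lost by
      moving within the ball, one to the growth of \<open>c\<close>, and the last one leaves the
      summable exponent \<open>- 1 - d\<close>.\<close>
    define d where "d = (Re x - 1) / 3"
    have d: "d > 0" using x by (simp add: d_def)
    from c[rule_format, OF d] obtain K where K: "K \<ge> 0" "\<And>n. n \<ge> 1 \<Longrightarrow> norm (c n) \<le> K * real n powr d" by blast
    show ?thesis
    proof (intro exI[of _ d] exI[of _ "\<lambda>n. K * real n powr (- 1 - d)"] conjI allI impI ballI)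
      show "summable (\<lambda>n. K * real n powr (- 1 - d))"
        by (intro summable_mult summable_powr) (use d in auto)
      fix n y assume n: "(n::nat) \<ge> 1" and y: "y \<in> ball x d \<inter> {s. Re s > 1}"
      have "\<bar>Re (x - y)\<bar> < d" using y abs_Re_le_cmod[of "x - y"] by (simp add: dist_norm)
      then have "Re y \<ge> Re x - d" by simp
      then have "Re y \<ge> 1 + 2 * d" by (simp add: d_def field_simps)
      then have "real n powr (- Re y) \<le> real n powr (- 1 - 2 * d)" using n by (intro powr_mono) auto
      then have "norm (c n * of_nat n powr (- y)) \<le> (K * real n powr d) * real n powr (- 1 - 2 * d)"
        unfolding norm_mult norm_of_nat_powr using K n by (intro mult_mono) auto
      also have "\<dots> = K * real n powr (- 1 - d)"
      proof -
        have "d + (- 1 - 2 * d) = - 1 - d" by simp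
        then show ?thesis by (simp only: mult.assoc powr_add[symmetric])
      qed
      finally show "norm (c n * of_nat n powr (- y)) \<le> K * real n powr (- 1 - d)" .
    qed (use d K in auto)
  qed
  show "summable (\<lambda>n. norm (c n * of_nat n powr (- s)))" if "Re s > 1"
  proof -
    from bnd[OF that] obtain d h where dh: "d > 0" "summable h"
      "\<And>n y. n \<ge> 1 \<Longrightarrow> y \<in> ball s d \<inter> {s. Re s > 1} \<Longrightarrow> norm (c n * of_nat n powr (- y)) \<le> h n" by blast
    show ?thesis
      by (rule summable_comparison_test'[OF dh(2), of 1]) (use that dh(1) dh(3)[of _ s] in simp)
  qed
  note * = suminf_holomorphic_local[where S = "{s. Re s > 1}" and f = "\<lambda>n s. c n * of_nat n powr (- s)", OF open_halfspace_Re_gt]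
  show "(\<lambda>s. \<Sum>n. c n * of_nat n powr (- s)) holomorphic_on {s. Re s > 1}"
    by (rule *(1)) (intro holomorphic_intros, rule bnd, simp)
  have "deriv (\<lambda>s. c n * of_nat n powr (- s)) s = - of_real (ln (real n)) * (c n * of_nat n powr (- s))" for n s
    using DERIV_cmult[OF of_nat_powr_has_field_derivative, THEN DERIV_imp_deriv, of "c n" n s] by simp
  moreover have "(\<lambda>n. deriv (\<lambda>s. c n * of_nat n powr (- s)) s) sums deriv (\<lambda>s. \<Sum>n. c n * of_nat n powr (- s)) s" if "Re s > 1"
    by (rule *(3)) (intro holomorphic_intros, rule bnd, simp, use that in simp)
  ultimately show "(\<lambda>n. - of_real (ln (real n)) * (c n * of_nat n powr (- s))) sums
           deriv (\<lambda>s. \<Sum>n. c n * of_nat n powr (- s)) s" if "Re s > 1" using that by simp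
qed

section \<open>Continuation of (s-1) zeta(s) to Re s > 0\<close>

text \<open>For n >= 1 this is (s-1) times the difference between n^(-s) and the integral of x^(-s)
  over [n, n+1]. At n = 0 it is 1, which accounts for the pole of zeta, and the powers n^(1-s)
  telescope from 0.\<close>

definition zeta_term :: "nat \<Rightarrow> complex \<Rightarrow> complex" where
  "zeta_term n s = of_nat (Suc n) powr (1 - s) - of_nat n powr (1 - s) + (s - 1) * of_nat n powr (- s)"

lemma zeta_term_0: "zeta_term 0 s = 1"
  by (simp add: zeta_term_def)

lemma holomorphic_on_zeta_term [holomorphic_intros]:
  "f holomorphic_on A \<Longrightarrow> (\<lambda>s. zeta_term n (f s)) holomorphic_on A"
  unfolding zeta_term_def by (intro holomorphic_intros)

text \<open>The term is the remainder of the first-order Taylor expansion of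
  \<open>z powr (1 - s)\<close> at \<open>n\<close>, evaluated at \<open>n + 1\<close>. The second
  derivative gains one power of \<open>n\<close> over the terms of the zeta series.\<close>

lemma norm_zeta_term_le:
  assumes n: "n \<ge> 1" and s: "Re s > 0"
  shows "norm (zeta_term n s) \<le> norm (s - 1) * norm s * real n powr (- 1 - Re s)"
proof -
  let ?S = "closed_segment (of_nat n) (of_nat (Suc n)) :: complex set"
  define f where "f = (\<lambda>(i::nat) z::complex. if i = 0 then z powr (1 - s) else if i = 1 then (1 - s) * z powr (- s)
     else (1 - s) * (- s) * z powr (- s - 1))"
  have mem: "z \<in> \<real> \<and> Re z \<ge> real n" if z: "z \<in> ?S" for z
  proof -
    obtain u where "0 \<le> u" "z = (1 - u) *\<^sub>R of_nat n + u *\<^sub>R of_nat (Suc n)"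
      using z by (auto simp: in_segment)
    then show ?thesis by (auto simp: complex_is_Real_iff algebra_simps)
  qed
  have nonpos: "z \<notin> \<real>\<^sub>\<le>\<^sub>0" if "z \<in> ?S" for z
    using mem[OF that] n by (auto simp: complex_nonpos_Reals_iff)
  have "norm (f 0 (of_nat (Suc n)) - (\<Sum>i\<le>1. f i (of_nat n) * (of_nat (Suc n) - of_nat n) ^ i / fact i))
      \<le> (norm (s - 1) * norm s * real n powr (- 1 - Re s)) * norm (of_nat (Suc n) - of_nat n :: complex) ^ Suc 1 / fact 1"
  proof (rule complex_Taylor[where S = ?S])
    fix i z assume z: "z \<in> ?S" and i: "i \<le> (1::nat)"
    have "(f i has_field_derivative f (Suc i) z) (at z)"
    proof (cases "i = 0")
      case True
      then show ?thesis
        using has_field_derivative_powr[OF nonpos[OF z], of "1 - s"] by (simp add: f_def)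
    next
      case False
      then have "i = 1" using i by simp
      then show ?thesis
        using DERIV_cmult[OF has_field_derivative_powr[OF nonpos[OF z], of "- s"], of "1 - s"] by (simp add: f_def mult.assoc)
    qed
    then show "(f i has_field_derivative f (Suc i) z) (at z within ?S)"
      by (rule has_field_derivative_at_within)
  next
    fix z assume z: "z \<in> ?S"
    have "norm (z powr (- s - 1)) = Re z powr (- Re s - 1)"
      using norm_powr_real_powr[of z "- s - 1"] mem[OF z] by simp
    also have "\<dots> \<le> real n powr (- Re s - 1)"
      using mem[OF z] n s by (intro powr_mono2') auto
    finally show "norm (f (Suc 1) z) \<le> norm (s - 1) * norm s * real n powr (- 1 - Re s)"
      unfolding f_def norm_mult minus_diff_commute[of "Re s" 1] norm_minus_commute[of s 1]
      by (simp add: norm_mult mult_left_mono)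
  qed auto
  then show ?thesis by (simp add: f_def zeta_term_def algebra_simps)
qed

text \<open>\<open>zeta1 s\<close> is \<open>(s - 1) \<zeta>(s)\<close>; the series of second-order differences converges already for \<open>Re s > 0\<close>.\<close>

definition zeta1 :: "complex \<Rightarrow> complex" where
  "zeta1 s = (\<Sum>n. zeta_term n s)"

lemma zeta1_1: "zeta1 1 = 1"
proof -
  have "zeta_term n 1 = (if n = 0 then 1 else 0)" for n
    using of_nat_neq_0[of n, where ?'a = complex] by (auto simp: zeta_term_def)
  then have "zeta1 1 = (\<Sum>n. if n = 0 then 1 else 0)" by (simp add: zeta1_def)
  also have "\<dots> = 1" using suminf_finite[of "{0::nat}" "\<lambda>n. if n = 0 then 1 else 0 :: complex"] by simp
  finally show ?thesis .
qed

lemma zeta_term_series_holomorphic: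
  fixes c :: "nat \<Rightarrow> complex"
  assumes c: "\<And>n. norm (c n) \<le> K * real n powr a" and a: "a \<ge> 0"
  shows "(\<lambda>s. \<Sum>n. c n * zeta_term n s) holomorphic_on {s. Re s > a}"
    and "Re s > a \<Longrightarrow> summable (\<lambda>n. c n * zeta_term n s)"
proof -
  have K: "K \<ge> 0" using c[of 1] norm_ge_zero[of "c 1"] by (simp del: norm_ge_zero)
  have bnd: "\<exists>d h. d > 0 \<and> summable h \<and> (\<forall>n. h n \<ge> 0) \<and>
      (\<forall>n\<ge>1. \<forall>y\<in>ball x d \<inter> {s. Re s > a}. norm (c n * zeta_term n y) \<le> h n)" if x: "Re x > a" for x
  proof -
    define d where "d = (Re x - a) / 2"
    have d: "d > 0" using x by (simp add: d_def)
    define L where "L = K * ((norm x + d + 1) * (norm x + d))"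
    have L: "L \<ge> 0" using K d by (auto simp: L_def)
    show ?thesis
    proof (intro exI[of _ d] exI[of _ "\<lambda>n. L * real n powr (- 1 - d)"] conjI allI impI ballI)
      show "summable (\<lambda>n. L * real n powr (- 1 - d))"
        by (intro summable_mult summable_powr) (use d in auto)
      fix n y assume n: "(n::nat) \<ge> 1" and y: "y \<in> ball x d \<inter> {s. Re s > a}"
      have "\<bar>Re (x - y)\<bar> < d" using y abs_Re_le_cmod[of "x - y"] by (simp add: dist_norm)
      then have "Re y \<ge> Re x - d" by simp
      then have Re: "Re y \<ge> a + d" by (simp add: d_def field_simps)
      have ny: "norm y \<le> norm x + d" using y norm_triangle_ineq2[of y x] by (simp add: dist_norm norm_minus_commute)
      have ny1: "norm (y - 1) \<le> norm x + d + 1" using ny norm_triangle_ineq4[of y 1] by simp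
      have "norm (c n * zeta_term n y) \<le> (K * real n powr a) * (norm (y - 1) * norm y * real n powr (- 1 - Re y))"
        unfolding norm_mult using c K norm_zeta_term_le[OF n, of y] y a by (intro mult_mono) auto
      also have "\<dots> \<le> (K * real n powr a) * ((norm x + d + 1) * (norm x + d) * real n powr (- 1 - a - d))"
        using K ny ny1 Re n d by (intro mult_left_mono mult_mono powr_mono mult_nonneg_nonneg) auto
      also have "\<dots> = L * (real n powr a * real n powr (- 1 - a - d))" by (simp add: L_def mult_ac)
      also have "real n powr a * real n powr (- 1 - a - d) = real n powr (- 1 - d)" by (simp flip: powr_add)
      finally show "norm (c n * zeta_term n y) \<le> L * real n powr (- 1 - d)" .
    qed (use d L in auto)
  qed
  note * = suminf_holomorphic_local[where S = "{s. Re s > a}" and f = "\<lambda>n s. c n * zeta_term n s", OF open_halfspace_Re_gt]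
  show "(\<lambda>s. \<Sum>n. c n * zeta_term n s) holomorphic_on {s. Re s > a}"
    by (rule *(1)) (intro holomorphic_intros, rule bnd, simp)
  show "summable (\<lambda>n. c n * zeta_term n s)" if "Re s > a"
    by (rule *(2)) (intro holomorphic_intros, rule bnd, simp, use that in simp)
qed

lemma zeta1_holomorphic: "zeta1 holomorphic_on {s. Re s > 0}"
  and zeta_term_sums: "Re s > 0 \<Longrightarrow> (\<lambda>n. zeta_term n s) sums zeta1 s"
proof -
  \<comment> \<open>Since \<open>0 powr 0 = 0\<close>, the growth bound forces the coefficient of
    index 0 to vanish; the term 1 of that index is added back afterwards.\<close>
  define c where "c = (\<lambda>n::nat. if n = 0 then 0 else 1 :: complex)"
  have c: "norm (c n) \<le> 1 * real n powr 0" for n by (simp add: c_def)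
  have sum: "(\<lambda>n. zeta_term n s) sums (1 + (\<Sum>n. c n * zeta_term n s))" if "Re s > 0" for s
  proof -
    have "(\<lambda>n::nat. (if n = 0 then 1 else 0) + c n * zeta_term n s) sums (1 + (\<Sum>n. c n * zeta_term n s))"
      by (rule sums_add[OF sums_single summable_sums[OF zeta_term_series_holomorphic(2)[OF c order_refl that]]])
    also have "(\<lambda>n::nat. (if n = 0 then 1 else 0) + c n * zeta_term n s) = (\<lambda>n. zeta_term n s)"
      by (auto simp: c_def zeta_term_0)
    finally show ?thesis .
  qed
  have eq: "zeta1 s = 1 + (\<Sum>n. c n * zeta_term n s)" if "Re s > 0" for s
    unfolding zeta1_def using sum[OF that] by (rule sums_unique[symmetric])
  show "(\<lambda>n. zeta_term n s) sums zeta1 s" if "Re s > 0" using sum[OF that] eq[OF that] by simp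
  have "(\<lambda>s. 1 + (\<Sum>n. c n * zeta_term n s)) holomorphic_on {s. Re s > 0}"
    by (intro holomorphic_on_add holomorphic_on_const zeta_term_series_holomorphic(1)[OF c order_refl])
  then show "zeta1 holomorphic_on {s. Re s > 0}"
    by (rule holomorphic_transform) (use eq in auto)
qed

section \<open>Dirichlet convolution and the logarithmic derivative of zeta\<close>

text \<open>Absolute convergence allows the double series over (k, m) to be regrouped by n = km, and
  \<open>e k * e m = e n\<close>. The regrouping takes place over positive indices, where every n
  has finitely many divisors; \<open>e 0 = 0\<close> makes this restriction harmless.\<close>

lemma dirichlet_product_sums:
  fixes c e :: "nat \<Rightarrow> complex"
  assumes e0: "e 0 = 0" and e_mult: "\<And>m n. e (m * n) = e m * e n"
    and c: "summable (\<lambda>n. norm (c n * e n))" and e: "summable (\<lambda>n. norm (e n))"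
  shows "(\<lambda>n. (\<Sum>d | d dvd n. c d) * e n) sums ((\<Sum>n. c n * e n) * (\<Sum>n. e n))"
proof -
  let ?P = "{0<..} :: nat set"
  define A where "A = (\<Sum>n. c n * e n)"
  define B where "B = (\<Sum>n. e n)"
  have pos: "(f has_sum S) UNIV \<longleftrightarrow> (f has_sum S) ?P" if "f 0 = 0" for f :: "nat \<Rightarrow> complex" and S
    by (rule has_sum_cong_neutral) (use that in auto)
  have hA: "((\<lambda>n. c n * e n) has_sum A) ?P"
    by (subst pos[symmetric]) (use e0 c norm_summable_imp_has_sum[of "\<lambda>n. c n * e n" A] in \<open>auto simp: A_def summable_sums summable_norm_cancel\<close>)
  have hB: "(e has_sum B) ?P"
    by (subst pos[symmetric]) (use e0 e norm_summable_imp_has_sum[of e B] in \<open>auto simp: B_def summable_sums summable_norm_cancel\<close>)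
  have absA: "(\<lambda>n. norm (c n * e n)) summable_on ?P"
    by (rule summable_on_subset_banach[of _ UNIV]) (use c norm_summable_imp_summable_on[of "\<lambda>n. norm (c n * e n)"] in auto)
  have absB: "(\<lambda>n. norm (e n)) summable_on ?P"
    by (rule summable_on_subset_banach[of _ UNIV]) (use e norm_summable_imp_summable_on[of "\<lambda>n. norm (e n)"] in auto)
  have "(\<lambda>x. norm (case x of (k, m) \<Rightarrow> c k * e k * e m)) summable_on (?P \<times> ?P)"
    unfolding Infinite_Sum.abs_summable_on_Sigma_iff
  proof (intro conjI ballI)
    fix k show "(\<lambda>m. norm (case (k, m) of (k, m) \<Rightarrow> c k * e k * e m)) summable_on ?P"
      using summable_on_cmult_right[OF absB, of "norm (c k * e k)"] by (simp add: norm_mult)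
  next
    have "(\<lambda>k. norm (c k * e k) * infsum (\<lambda>m. norm (e m)) ?P) summable_on ?P"
      by (rule summable_on_cmult_left[OF absA])
    also have "(\<lambda>k. norm (c k * e k) * infsum (\<lambda>m. norm (e m)) ?P) =
        (\<lambda>k. norm (\<Sum>\<^sub>\<infinity>m\<in>?P. norm (case (k, m) of (k, m) \<Rightarrow> c k * e k * e m)))"
    proof
      fix k
      have "(\<Sum>\<^sub>\<infinity>m\<in>?P. norm (case (k, m) of (k, m) \<Rightarrow> c k * e k * e m)) = (\<Sum>\<^sub>\<infinity>m\<in>?P. norm (c k * e k) * norm (e m))"
        by (simp add: norm_mult)
      also have "\<dots> = norm (c k * e k) * infsum (\<lambda>m. norm (e m)) ?P"
        by (rule infsum_cmult_right) (use absB in auto)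
      finally show "norm (c k * e k) * infsum (\<lambda>m. norm (e m)) ?P =
          norm (\<Sum>\<^sub>\<infinity>m\<in>?P. norm (case (k, m) of (k, m) \<Rightarrow> c k * e k * e m))"
        by (simp add: infsum_nonneg)
    qed
    finally show "(\<lambda>k. norm (\<Sum>\<^sub>\<infinity>m\<in>?P. norm (case (k, m) of (k, m) \<Rightarrow> c k * e k * e m))) summable_on ?P" .
  qed
  then have "(\<lambda>(k, m). c k * e k * e m) summable_on (?P \<times> ?P)"
    by (rule abs_summable_summable)
  then have "((\<lambda>(k, m). c k * e k * e m) has_sum (A * B)) (?P \<times> ?P)"
    by (intro has_sum_SigmaI[where g = "\<lambda>k. c k * e k * B"])
       (use has_sum_cmult_right[OF hB] has_sum_cmult_left[OF hA] in auto)
  also have "((\<lambda>(k, m). c k * e k * e m) has_sum (A * B)) (?P \<times> ?P) \<longleftrightarrow>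
      ((\<lambda>(n, d). c d * e n) has_sum (A * B)) (Sigma ?P (\<lambda>n. {d. d dvd n}))"
    by (rule has_sum_reindex_bij_witness[of _ "\<lambda>(n, d). (d, n div d)" "\<lambda>(k, m). (k * m, k)"])
       (auto simp: e_mult dvd_pos_nat intro!: Nat.gr0I)
  finally have "((\<lambda>n. \<Sum>d | d dvd n. c d * e n) has_sum (A * B)) ?P"
    by (rule has_sum_SigmaD) (auto intro!: has_sum_finiteI)
  then have "((\<lambda>n. (\<Sum>d | d dvd n. c d) * e n) has_sum (A * B)) ?P"
    by (simp add: sum_distrib_right)
  then have "((\<lambda>n. (\<Sum>d | d dvd n. c d) * e n) has_sum (A * B)) UNIV"
    by (subst pos) (use e0 in auto)
  then show ?thesis unfolding A_def B_def by (rule has_sum_imp_sums)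
qed

definition zeta_series :: "complex \<Rightarrow> complex" where
  "zeta_series s = (\<Sum>n. of_nat n powr (- s))"

definition mangoldt_series :: "complex \<Rightarrow> complex" where
  "mangoldt_series s = (\<Sum>n. mangoldt n * of_nat n powr (- s))"

lemma one_le_powr: "\<forall>e>0. \<exists>K\<ge>0. \<forall>n\<ge>1. norm (1::complex) \<le> K * real n powr e"
  by (intro allI impI exI[of _ 1]) (auto simp: ge_one_powr_ge_zero)

lemma mangoldt_le_powr: "\<forall>e>0. \<exists>K\<ge>0. \<forall>n\<ge>1. norm (mangoldt n :: complex) \<le> K * real n powr e"
proof (intro allI impI)
  fix e :: real assume e: "e > 0"
  have "norm (mangoldt n :: complex) \<le> 1 / e * real n powr e" if "n \<ge> 1" for n
    using mangoldt_le[of n] ln_powr_bound[of "real n" e] that e by simp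
  then show "\<exists>K\<ge>0. \<forall>n\<ge>1. norm (mangoldt n :: complex) \<le> K * real n powr e"
    using e by (intro exI[of _ "1 / e"]) auto
qed

lemmas zeta_dirichlet_series =
  dirichlet_series[where c = "\<lambda>_. 1", OF one_le_powr, unfolded mult_1_left, folded zeta_series_def]

lemmas mangoldt_dirichlet_series =
  dirichlet_series[where c = mangoldt, OF mangoldt_le_powr, folded mangoldt_series_def]

text \<open>The partial sums telescope exactly, leaving the boundary term
  \<open>N powr (1 - s)\<close>, which tends to 0 only for Re s > 1.\<close>

lemma zeta1_eq:
  assumes s: "Re s > 1"
  shows "zeta1 s = (s - 1) * zeta_series s"
proof -
  have "(\<Sum>n<N. zeta_term n s) = of_nat N powr (1 - s) + (s - 1) * (\<Sum>n<N. of_nat n powr (- s))" for N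
    by (induction N) (auto simp: zeta_term_def algebra_simps)
  moreover have "(\<lambda>N. of_nat N powr (1 - s) + (s - 1) * (\<Sum>n<N. of_nat n powr (- s))) \<longlonglongrightarrow> 0 + (s - 1) * zeta_series s"
  proof (intro tendsto_add tendsto_mult tendsto_const)
    have "(\<lambda>N. real N powr (1 - Re s)) \<longlonglongrightarrow> 0" using s by real_asymp
    then show "(\<lambda>N. of_nat N powr (1 - s)) \<longlonglongrightarrow> 0"
      by (subst tendsto_norm_zero_iff[symmetric]) (simp add: norm_of_nat_powr)
    show "(\<lambda>N. \<Sum>n<N. of_nat n powr (- s)) \<longlonglongrightarrow> zeta_series s"
      using summable_sums[OF summable_norm_cancel[OF zeta_dirichlet_series(1)[OF s]]]
      by (simp add: sums_def zeta_series_def)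
  qed
  ultimately have "(\<lambda>n. zeta_term n s) sums ((s - 1) * zeta_series s)"
    by (simp add: sums_def)
  with zeta_term_sums[of s] s show ?thesis by (simp add: sums_unique2)
qed

text \<open>The divisor sum of the von Mangoldt function is the logarithm, so the product of the two
  Dirichlet series is -zeta'. The identity is kept in product form because nonvanishing for Re s > 1
  is itself deduced from it.\<close>

lemma deriv_zeta1:
  assumes s: "Re s > 1"
  shows "deriv zeta1 s = (1 / (s - 1) - mangoldt_series s) * zeta1 s"
proof -
  have "(\<lambda>n. (\<Sum>d | d dvd n. mangoldt d) * of_nat n powr (- s)) sums (mangoldt_series s * zeta_series s)"
    unfolding mangoldt_series_def zeta_series_def
    by (rule dirichlet_product_sums)
       (use mangoldt_dirichlet_series(1)[OF s] zeta_dirichlet_series(1)[OF s] in \<open>auto simp: powr_times_real_left\<close>)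
  also have "(\<lambda>n. (\<Sum>d | d dvd n. mangoldt d) * of_nat n powr (- s)) = (\<lambda>n. of_real (ln (real n)) * of_nat n powr (- s))"
  proof
    fix n show "(\<Sum>d | d dvd n. mangoldt d) * of_nat n powr (- s) = of_real (ln (real n)) * of_nat n powr (- s)"
      by (cases "n = 0") (simp_all add: mangoldt_sum)
  qed
  finally have "(\<lambda>n. - of_real (ln (real n)) * of_nat n powr (- s)) sums (- (mangoldt_series s * zeta_series s))"
    using sums_minus by fastforce
  with zeta_dirichlet_series(3)[OF s] have d: "deriv zeta_series s = - (mangoldt_series s * zeta_series s)"
    by (rule sums_unique2)
  have "(zeta_series has_field_derivative deriv zeta_series s) (at s)"
    using zeta_dirichlet_series(2) s by (intro holomorphic_derivI[OF _ open_halfspace_Re_gt[of 1]]) auto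
  then have "((\<lambda>s. (s - 1) * zeta_series s) has_field_derivative ((s - 1) * - (mangoldt_series s * zeta_series s) + zeta_series s)) (at s)"
    unfolding d by (auto intro!: derivative_eq_intros)
  then have "(zeta1 has_field_derivative ((s - 1) * - (mangoldt_series s * zeta_series s) + zeta_series s)) (at s)"
    by (rule has_field_derivative_transform_within_open[OF _ open_halfspace_Re_gt[of 1]]) (use s zeta1_eq in auto)
  then have "deriv zeta1 s = (s - 1) * - (mangoldt_series s * zeta_series s) + zeta_series s"
    by (rule DERIV_imp_deriv)
  also have "\<dots> = (1 / (s - 1) - mangoldt_series s) * zeta1 s"
    using s unfolding zeta1_eq[OF s] by (cases "s = 1") (auto simp: field_simps)
  finally show ?thesis .
qed

section \<open>Nonvanishing of zeta on Re s >= 1\<close>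

text \<open>The residue of f'/f is the order of the zero. It is read off along a horizontal approach
  from the right, where the Dirichlet series will be available. The point \<open>w\<close> and
  connectedness exclude f = 0 identically, so the order is finite.\<close>

lemma logarithmic_derivative_at_zero:
  assumes f: "f holomorphic_on S" and S: "open S" "connected S" and z: "z \<in> S"
    and w: "w \<in> S" "f w \<noteq> 0"
  shows "\<exists>m::nat. (m = 0 \<longleftrightarrow> f z \<noteq> 0) \<and>
    ((\<lambda>e. of_real e * (deriv f (z + of_real e) / f (z + of_real e))) \<longlongrightarrow> of_nat m) (at_right 0)"
proof (cases "f z = 0")
  case False
  have shift: "((\<lambda>e. z + of_real e) \<longlongrightarrow> z) (at_right (0::real))"
    by (auto intro!: tendsto_eq_intros)
  have lim: "((\<lambda>e. g (z + of_real e)) \<longlongrightarrow> g z) (at_right (0::real))" if "g holomorphic_on S" for g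
    by (rule isCont_tendsto_compose[OF field_differentiable_imp_continuous_at[OF holomorphic_on_imp_differentiable_at[OF that S(1) z]] shift])
  have "((\<lambda>e. of_real e * (deriv f (z + of_real e) / f (z + of_real e))) \<longlongrightarrow> of_real 0 * (deriv f z / f z)) (at_right 0)"
    by (intro tendsto_mult[OF tendsto_of_real[OF tendsto_ident_at] tendsto_divide[OF lim[OF holomorphic_deriv[OF f S(1)]] lim[OF f] False]])
  then show ?thesis using False by (intro exI[of _ 0]) simp
next
  case True
  have nc: "\<not> f constant_on S"
  proof
    assume "f constant_on S"
    then have "f z = f w" using z w(1) by (auto simp: constant_on_def)
    then show False using True w(2) by simp
  qed
  obtain g r n
    where g: "0 < n" "0 < r" "ball z r \<subseteq> S" "g holomorphic_on ball z r"
      "\<And>w. w \<in> ball z r \<Longrightarrow> f w = (w - z) ^ n * g w" "\<And>w. w \<in> ball z r \<Longrightarrow> g w \<noteq> 0"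
    by (rule holomorphic_factor_zero_nonconstant[OF f S z True nc], rule that)
  have shift: "((\<lambda>e. z + of_real e) \<longlongrightarrow> z) (at_right (0::real))"
    by (auto intro!: tendsto_eq_intros)
  have lim: "((\<lambda>e. h (z + of_real e)) \<longlongrightarrow> h z) (at_right (0::real))" if "h holomorphic_on ball z r" for h
    by (rule isCont_tendsto_compose[OF field_differentiable_imp_continuous_at[OF holomorphic_on_imp_differentiable_at[OF that open_ball]] shift]) (use g(2) in simp)
  have "((\<lambda>e. of_nat n + of_real e * (deriv g (z + of_real e) / g (z + of_real e))) \<longlongrightarrow> of_nat n + of_real 0 * (deriv g z / g z)) (at_right 0)"
    by (intro tendsto_add[OF tendsto_const tendsto_mult[OF tendsto_of_real[OF tendsto_ident_at] tendsto_divide[OF lim[OF holomorphic_deriv[OF g(4) open_ball]] lim[OF g(4)] g(6)]]]) (use g(2) in simp)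
  moreover have "\<forall>\<^sub>F e in at_right 0. of_nat n + of_real e * (deriv g (z + of_real e) / g (z + of_real e)) =
      of_real e * (deriv f (z + of_real e) / f (z + of_real e))"
  proof -
    have "\<forall>\<^sub>F e in at_right 0. e \<in> {0<..<r}" by (rule eventually_at_right_real[OF g(2)])
    then show ?thesis
    proof eventually_elim
      case (elim e)
      define u where "u = z + of_real e"
      have u: "u \<in> ball z r" using elim by (auto simp: u_def dist_norm)
      have "(g has_field_derivative deriv g u) (at u)"
        using g(4) u by (intro holomorphic_derivI[OF _ open_ball])
      moreover have "((\<lambda>w. (w - z) ^ n) has_field_derivative of_nat n * (u - z) ^ (n - 1)) (at u)"
        by (auto intro!: derivative_eq_intros)
      ultimately have "((\<lambda>w. (w - z) ^ n * g w) has_field_derivative (of_nat n * (u - z) ^ (n - 1) * g u + (u - z) ^ n * deriv g u)) (at u)"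
        using DERIV_mult[of "\<lambda>w. (w - z) ^ n" "of_nat n * (u - z) ^ (n - 1)" u UNIV g "deriv g u"] by (simp only: mult_ac add_ac)
      then have "(f has_field_derivative (of_nat n * (u - z) ^ (n - 1) * g u + (u - z) ^ n * deriv g u)) (at u)"
        by (rule has_field_derivative_transform_within_open[OF _ open_ball u]) (use g(5) in auto)
      then have df: "deriv f u = of_nat n * (u - z) ^ (n - 1) * g u + (u - z) ^ n * deriv g u"
        by (rule DERIV_imp_deriv)
      have uz: "u - z = of_real e" by (simp add: u_def)
      have pw: "(of_real e :: complex) ^ n = of_real e * of_real e ^ (n - 1)"
        using g(1) by (cases n) auto
      have alg: "n' + x * (d / y) = x * ((n' * P * y + x * P * d) / (x * P * y))"
        if "x \<noteq> 0" "P \<noteq> 0" "y \<noteq> 0" for n' x d y P :: complex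
        using that by (simp add: field_simps)
      show ?case unfolding u_def[symmetric] df g(5)[OF u] uz pw
        by (rule alg) (use elim g(6)[OF u] in auto)
    qed
  qed
  ultimately have "((\<lambda>e. of_real e * (deriv f (z + of_real e) / f (z + of_real e))) \<longlongrightarrow> of_nat n + of_real 0 * (deriv g z / g z)) (at_right 0)"
    by (rule Lim_transform_eventually)
  then show ?thesis using True g(1) by (intro exI[of _ n]) simp
qed

lemma zeta1_order:
  assumes "Re s > 0"
  shows "\<exists>m::nat. (m = 0 \<longleftrightarrow> zeta1 s \<noteq> 0) \<and>
    ((\<lambda>e. of_real e * (deriv zeta1 (s + of_real e) / zeta1 (s + of_real e))) \<longlongrightarrow> of_nat m) (at_right 0)"
  by (rule logarithmic_derivative_at_zero[OF zeta1_holomorphic, of s 1])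
     (use assms in \<open>auto simp: open_halfspace_Re_gt zeta1_1 intro!: convex_connected convex_halfspace_Re_gt\<close>)

text \<open>No Euler product is used. A zero of order m would make \<open>e * zeta1' / zeta1\<close>
  at \<open>s + e\<close> tend to m, but the preceding identity bounds it by \<open>e\<close> times
  a function continuous at \<open>s\<close>, so m = 0.\<close>

lemma zeta1_nonzero_Re_gt_1:
  assumes s: "Re s > 1"
  shows "zeta1 s \<noteq> 0"
proof -
  obtain m :: nat where m: "m = 0 \<longleftrightarrow> zeta1 s \<noteq> 0"
    "((\<lambda>e. of_real e * (deriv zeta1 (s + of_real e) / zeta1 (s + of_real e))) \<longlongrightarrow> of_nat m) (at_right 0)"
    using zeta1_order[of s] s by (meson less_trans zero_less_one)
  let ?h = "\<lambda>w. 1 / (w - 1) - mangoldt_series w"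
  have "?h holomorphic_on {s. Re s > 1}"
    by (intro holomorphic_intros mangoldt_dirichlet_series(2)) auto
  then have "isCont ?h s"
    using s by (intro field_differentiable_imp_continuous_at holomorphic_on_imp_differentiable_at[OF _ open_halfspace_Re_gt[of 1]]) auto
  moreover have "((\<lambda>e. s + of_real e) \<longlongrightarrow> s) (at_right (0::real))"
    by (auto intro!: tendsto_eq_intros)
  ultimately have "((\<lambda>e. ?h (s + of_real e)) \<longlongrightarrow> ?h s) (at_right (0::real))"
    by (rule isCont_tendsto_compose)
  then have "((\<lambda>e. of_real e * ?h (s + of_real e)) \<longlongrightarrow> of_real 0 * ?h s) (at_right (0::real))"
    by (intro tendsto_mult tendsto_of_real tendsto_ident_at)
  then have "((\<lambda>e. norm (of_real e * ?h (s + of_real e))) \<longlongrightarrow> 0) (at_right (0::real))"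
    by (simp add: tendsto_norm_zero)
  then have "((\<lambda>e. of_real e * (deriv zeta1 (s + of_real e) / zeta1 (s + of_real e))) \<longlongrightarrow> 0) (at_right 0)"
  proof (rule Lim_null_comparison[rotated])
    show "\<forall>\<^sub>F e in at_right 0. norm (of_real e * (deriv zeta1 (s + of_real e) / zeta1 (s + of_real e))) \<le> norm (of_real e * ?h (s + of_real e))"
      using eventually_at_right_less[of "0::real"]
    proof eventually_elim
      case (elim e)
      have "Re (s + of_real e) > 1" using s elim by simp
      \<comment> \<open>If \<open>zeta1\<close> vanishes at the shifted point, the quotient is 0 by
        the convention for division, and the bound still holds.\<close>
      from deriv_zeta1[OF this] show ?case by (cases "zeta1 (s + of_real e) = 0") (auto simp: norm_mult)
    qed
  qed
  then have "of_nat m = (0::complex)" using m(2) tendsto_unique trivial_limit_at_right_real by blast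
  then show ?thesis using m(1) by simp
qed

text \<open>By \<open>deriv_zeta1\<close> the series is 1/(s-1) minus the logarithmic derivative of
  \<open>zeta1\<close>: the first part contributes 1 at t = 0 only, the second minus the order of
  the zero at 1 + it.\<close>

lemma mangoldt_series_pole:
  "\<exists>m::nat. (m = 0 \<longleftrightarrow> zeta1 (1 + \<i> * of_real t) \<noteq> 0) \<and>
    ((\<lambda>e. of_real e * mangoldt_series (1 + \<i> * of_real t + of_real e)) \<longlongrightarrow> (if t = 0 then 1 else - of_nat m)) (at_right 0)"
proof -
  let ?s = "1 + \<i> * of_real t"
  have Re_s: "Re ?s > 0" by simp
  obtain m :: nat where m: "m = 0 \<longleftrightarrow> zeta1 ?s \<noteq> 0"
    "((\<lambda>e. of_real e * (deriv zeta1 (?s + of_real e) / zeta1 (?s + of_real e))) \<longlongrightarrow> of_nat m) (at_right 0)"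
    using zeta1_order[of ?s] by (meson Re_s)
  have m0: "m = 0" if "t = 0" using m(1) that by (simp add: zeta1_1)
  have "((\<lambda>e. of_real e / (\<i> * of_real t + of_real e)) \<longlongrightarrow> (if t = 0 then 1 else 0 :: complex)) (at_right (0::real))"
  proof (cases "t = 0")
    case True
    have "\<forall>\<^sub>F e in at_right (0::real). of_real e / (\<i> * of_real t + of_real e) = (1::complex)"
      using eventually_at_right_less[of "0::real"] by eventually_elim (use True in auto)
    then show ?thesis using True by (auto intro!: tendsto_eventually)
  next
    case False
    have "((\<lambda>e. of_real e / (\<i> * of_real t + of_real e)) \<longlongrightarrow> of_real 0 / (\<i> * of_real t + of_real 0)) (at_right (0::real))"
      by (intro tendsto_divide tendsto_add tendsto_const tendsto_of_real tendsto_ident_at) (use False in simp)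
    then show ?thesis using False by simp
  qed
  then have "((\<lambda>e. of_real e / (\<i> * of_real t + of_real e) - of_real e * (deriv zeta1 (?s + of_real e) / zeta1 (?s + of_real e))) \<longlongrightarrow>
      (if t = 0 then 1 else 0) - of_nat m) (at_right 0)"
    by (rule tendsto_diff[OF _ m(2)])
  also have "(if t = 0 then 1 else 0) - of_nat m = (if t = 0 then 1 else - of_nat m :: complex)" using m0 by simp
  finally have *: "((\<lambda>e. of_real e / (\<i> * of_real t + of_real e) - of_real e * (deriv zeta1 (?s + of_real e) / zeta1 (?s + of_real e))) \<longlongrightarrow>
      (if t = 0 then 1 else - of_nat m)) (at_right 0)" .
  have "\<forall>\<^sub>F e in at_right 0. of_real e / (\<i> * of_real t + of_real e) - of_real e * (deriv zeta1 (?s + of_real e) / zeta1 (?s + of_real e)) =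
      of_real e * mangoldt_series (?s + of_real e)"
    using eventually_at_right_less[of "0::real"]
  proof eventually_elim
    case (elim e)
    have "Re (?s + of_real e) > 1" using elim by simp
    then have "deriv zeta1 (?s + of_real e) / zeta1 (?s + of_real e) = 1 / (?s + of_real e - 1) - mangoldt_series (?s + of_real e)"
      using deriv_zeta1 zeta1_nonzero_Re_gt_1 by simp
    then show ?case by (simp only: right_diff_distrib) simp
  qed
  with * have "((\<lambda>e. of_real e * mangoldt_series (?s + of_real e)) \<longlongrightarrow> (if t = 0 then 1 else - of_nat m)) (at_right 0)"
    by (rule Lim_transform_eventually)
  with m(1) show ?thesis by (intro exI[of _ m] conjI)
qed

text \<open>The classical inequality \<open>3 + 4 cos x + cos (2 x) = 2 (1 + cos x)^2 >= 0\<close>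
  with \<open>x = t ln n\<close>, summed with the nonnegative weights \<open>r n\<close>.\<close>

lemma mangoldt_series_3_4_1:
  assumes e: "e > 0"
  shows "3 * Re (mangoldt_series (1 + of_real e)) + 4 * Re (mangoldt_series (1 + \<i> * of_real t + of_real e))
     + Re (mangoldt_series (1 + \<i> * of_real (2 * t) + of_real e)) \<ge> 0"
proof -
  define r where "r = (\<lambda>n. mangoldt n * real n powr (- 1 - e))"
  have sums: "(\<lambda>n. r n * cos (t * ln (real n))) sums Re (mangoldt_series (1 + \<i> * of_real t + of_real e))" for t
  proof -
    let ?s = "1 + \<i> * of_real t + of_real e"
    have "Re ?s > 1" using e by simp
    from summable_sums[OF summable_norm_cancel[OF mangoldt_dirichlet_series(1)[OF this]]]
    have "(\<lambda>n. Re (mangoldt n * of_nat n powr (- ?s))) sums Re (mangoldt_series ?s)"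
      unfolding mangoldt_series_def by (rule sums_Re)
    moreover have "Re (mangoldt n * of_nat n powr (- ?s)) = r n * cos (t * ln (real n))" for n
    proof (cases "n = 0")
      case False
      have "Re (of_nat n powr (- ?s)) = exp (- (1 + e) * ln (real n)) * cos (t * ln (real n))"
      proof -
        have "of_nat n powr (- ?s) = exp (- ?s * of_real (ln (real n)))"
          using False by (simp add: powr_def Ln_of_nat)
        moreover have "Re (- ?s * of_real (ln (real n))) = - (1 + e) * ln (real n)"
          and "Im (- ?s * of_real (ln (real n))) = - (t * ln (real n))" by simp_all
        ultimately show ?thesis by (simp only: Re_exp cos_minus)
      qed
      also have "exp (- (1 + e) * ln (real n)) = real n powr (- 1 - e)"
        using False by (simp add: powr_def)
      finally show ?thesis by (simp add: r_def)
    qed (simp add: r_def)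
    ultimately show ?thesis by simp
  qed
  have S: "(\<lambda>n. 3 * (r n * cos (0 * ln (real n))) + 4 * (r n * cos (t * ln (real n))) + r n * cos (2 * t * ln (real n))) sums
     (3 * Re (mangoldt_series (1 + \<i> * of_real 0 + of_real e)) + 4 * Re (mangoldt_series (1 + \<i> * of_real t + of_real e))
     + Re (mangoldt_series (1 + \<i> * of_real (2 * t) + of_real e)))"
    by (intro sums_add sums_mult sums)
  have nonneg: "0 \<le> 3 * (r n * cos (0 * ln (real n))) + 4 * (r n * cos (t * ln (real n))) + r n * cos (2 * t * ln (real n))" for n
  proof -
    have "cos (2 * t * ln (real n)) = 2 * (cos (t * ln (real n)))\<^sup>2 - 1"
      using cos_double_cos[of "t * ln (real n)"] by (simp add: mult.assoc)
    have "3 * (r n * cos (0 * ln (real n))) + 4 * (r n * cos (t * ln (real n))) + r n * cos (2 * t * ln (real n))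
        = 2 * r n * (1 + cos (t * ln (real n)))\<^sup>2"
      unfolding \<open>cos (2 * t * ln (real n)) = _\<close> mult_zero_left cos_zero
      by (simp add: power2_eq_square distrib_left distrib_right right_diff_distrib)
    also have "\<dots> \<ge> 0" by (simp add: r_def mangoldt_nonneg)
    finally show ?thesis .
  qed
  have "0 \<le> 3 * Re (mangoldt_series (1 + \<i> * of_real 0 + of_real e)) + 4 * Re (mangoldt_series (1 + \<i> * of_real t + of_real e))
     + Re (mangoldt_series (1 + \<i> * of_real (2 * t) + of_real e))"
    by (rule sums_le[OF nonneg sums_zero S])
  then show ?thesis by simp
qed

text \<open>Multiplying the 3-4-1 inequality by \<open>e\<close> and letting \<open>e\<close> tend
  to 0 gives \<open>3 - 4 m - k >= 0\<close>, where m and k are the orders of the zeros at 1 + it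
  and 1 + 2it. Since k >= 0, this forces m = 0.\<close>

lemma zeta1_nonzero:
  assumes s: "Re s \<ge> 1"
  shows "zeta1 s \<noteq> 0"
proof (cases "Re s = 1 \<and> Im s \<noteq> 0")
  case False
  show ?thesis
  proof (cases "Re s = 1")
    case True
    then have "s = 1" using False by (simp add: complex_eq_iff)
    then show ?thesis by (simp add: zeta1_1)
  next
    case False
    then show ?thesis using s by (intro zeta1_nonzero_Re_gt_1) simp
  qed
next
  case True
  define t where "t = Im s"
  have t: "t \<noteq> 0" "s = 1 + \<i> * of_real t" using True by (auto simp: t_def complex_eq_iff)
  obtain m :: nat where m': "m = 0 \<longleftrightarrow> zeta1 (1 + \<i> * of_real t) \<noteq> 0"
    "((\<lambda>e. of_real e * mangoldt_series (1 + \<i> * of_real t + of_real e)) \<longlongrightarrow> (if t = 0 then 1 else - of_nat m)) (at_right 0)"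
    using mangoldt_series_pole by meson
  then have m: "((\<lambda>e. of_real e * mangoldt_series (1 + \<i> * of_real t + of_real e)) \<longlongrightarrow> - of_nat m) (at_right 0)"
    using t by simp
  obtain k :: nat where
    "((\<lambda>e. of_real e * mangoldt_series (1 + \<i> * of_real (2 * t) + of_real e)) \<longlongrightarrow> (if 2 * t = 0 then 1 else - of_nat k)) (at_right 0)"
    using mangoldt_series_pole by meson
  then have k: "((\<lambda>e. of_real e * mangoldt_series (1 + \<i> * of_real (2 * t) + of_real e)) \<longlongrightarrow> - of_nat k) (at_right 0)"
    using t by simp
  have o: "((\<lambda>e. of_real e * mangoldt_series (1 + of_real e)) \<longlongrightarrow> 1) (at_right 0)"
    using mangoldt_series_pole[of 0] by simp
  have "((\<lambda>e. 3 * Re (of_real e * mangoldt_series (1 + of_real e)) + 4 * Re (of_real e * mangoldt_series (1 + \<i> * of_real t + of_real e))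
     + Re (of_real e * mangoldt_series (1 + \<i> * of_real (2 * t) + of_real e))) \<longlongrightarrow> 3 * Re 1 + 4 * Re (- of_nat m) + Re (- of_nat k)) (at_right 0)"
    by (rule tendsto_add[OF tendsto_add[OF tendsto_mult[OF tendsto_const tendsto_Re[OF o]] tendsto_mult[OF tendsto_const tendsto_Re[OF m]]] tendsto_Re[OF k]])
  moreover have "\<forall>\<^sub>F e in at_right 0. 3 * Re (of_real e * mangoldt_series (1 + of_real e)) + 4 * Re (of_real e * mangoldt_series (1 + \<i> * of_real t + of_real e))
     + Re (of_real e * mangoldt_series (1 + \<i> * of_real (2 * t) + of_real e)) \<ge> 0"
    using eventually_at_right_less[of "0::real"]
  proof eventually_elim
    case (elim e)
    have "0 \<le> e * (3 * Re (mangoldt_series (1 + of_real e)) + 4 * Re (mangoldt_series (1 + \<i> * of_real t + of_real e))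
     + Re (mangoldt_series (1 + \<i> * of_real (2 * t) + of_real e)))"
      using mangoldt_series_3_4_1[OF elim, of t] elim by (intro mult_nonneg_nonneg) auto
    then show ?case by (simp add: algebra_simps)
  qed
  ultimately have "3 * Re 1 + 4 * Re (- of_nat m) + Re (- of_nat k) \<ge> 0"
    by (rule tendsto_lowerbound) simp
  then have "m = 0" by simp
  then show ?thesis using m'(1) t(2) by simp
qed

section \<open>The prime number theorem for the Chebyshev function\<close>

definition psi :: "nat \<Rightarrow> real" where
  "psi N = (\<Sum>n=1..N. mangoldt n)"

lemma psi_0 [simp]: "psi 0 = 0"
  by (simp add: psi_def)

lemma psi_Suc: "psi (Suc N) = psi N + mangoldt (Suc N)"
  by (simp add: psi_def)

lemma psi_mono: "m \<le> n \<Longrightarrow> psi m \<le> psi n"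
  unfolding psi_def by (intro sum_mono2) (auto simp: mangoldt_nonneg)

lemma psi_nonneg: "psi n \<ge> 0"
  using psi_mono[of 0 n] by simp

text \<open>Legendre's formula in logarithmic form. Passing from N to N + 1 raises
  \<open>N div d\<close> by one exactly when d divides N + 1, and the von Mangoldt function summed
  over those divisors is ln(N + 1).\<close>

lemma sum_mangoldt_div: "(\<Sum>d=1..N. mangoldt d * real (N div d)) = ln (fact N)"
proof (induction N)
  case (Suc N)
  have "(\<Sum>d=1..Suc N. mangoldt d * real (Suc N div d))
      = (\<Sum>d=1..Suc N. mangoldt d * real (N div d) + (if d dvd Suc N then mangoldt d else 0))"
    by (intro sum.cong) (auto simp: div_Suc dvd_eq_mod_eq_0 algebra_simps)
  also have "\<dots> = (\<Sum>d=1..Suc N. mangoldt d * real (N div d)) + (\<Sum>d=1..Suc N. if d dvd Suc N then mangoldt d else 0)"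
    by (rule sum.distrib)
  also have "(\<Sum>d=1..Suc N. mangoldt d * real (N div d)) = (\<Sum>d=1..N. mangoldt d * real (N div d))"
    by simp
  also have "(\<Sum>d=1..Suc N. if d dvd Suc N then mangoldt d else 0) = (\<Sum>d | d dvd Suc N. mangoldt d :: real)"
  proof (intro sum.mono_neutral_cong_right)
    have "0 < d \<and> d \<le> Suc N" if "d dvd Suc N" for d
      using that dvd_imp_le[of d "Suc N"] dvd_pos_nat[of "Suc N" d] by simp
    then show "{d. d dvd Suc N} \<subseteq> {1..Suc N}" by (auto simp: Suc_le_eq)
  qed auto
  also have "\<dots> = ln (real (Suc N))" by (subst mangoldt_sum) auto
  also have "(\<Sum>d=1..N. mangoldt d * real (N div d)) + ln (real (Suc N)) = ln (fact (Suc N))"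
    using Suc.IH by (simp add: ln_mult)
  finally show ?case .
qed simp

text \<open>Legendre's formula writes the logarithm of the central binomial coefficient with weights
  \<open>2 n div d - 2 (n div d)\<close>. These are nonnegative and equal 1 for n < d <= 2n, while
  the coefficient is at most 4^n; finally ln 2 <= 1.\<close>

lemma psi_double_le: "psi (2 * n) \<le> psi n + 2 * real n"
proof -
  have ext: "(\<Sum>d=1..n. mangoldt d * real (n div d)) = (\<Sum>d=1..2*n. mangoldt d * real (n div d))"
    by (intro sum.mono_neutral_left) auto
  have "psi (2 * n) - psi n = (\<Sum>d=n+1..2*n. mangoldt d)"
  proof -
    have "{1..2*n} = {1..n} \<union> {n+1..2*n}" by auto
    then have "psi (2 * n) = psi n + (\<Sum>d=n+1..2*n. mangoldt d)"
      unfolding psi_def by (simp only:) (rule sum.union_disjoint, auto)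
    then show ?thesis by simp
  qed
  also have "\<dots> = (\<Sum>d=n+1..2*n. mangoldt d * (real (2 * n div d) - 2 * real (n div d)))"
  proof (rule sum.cong)
    fix d assume "d \<in> {n+1..2*n}"
    then have "2 * n div d = 1" "n div d = 0" by (auto intro!: div_nat_eqI)
    then show "mangoldt d = mangoldt d * (real (2 * n div d) - 2 * real (n div d))" by simp
  qed simp
  also have "\<dots> \<le> (\<Sum>d=1..2*n. mangoldt d * (real (2 * n div d) - 2 * real (n div d)))"
  proof (rule sum_mono2)
    fix d assume "d \<in> {1..2*n} - {n+1..2*n}"
    have "2 * (n div d) \<le> 2 * n div d"
    proof (cases "d = 0")
      case False
      then show ?thesis
        using div_times_less_eq_dividend[of n d] by (simp add: less_eq_div_iff_mult_less_eq)
    qed simp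
    then show "0 \<le> mangoldt d * (real (2 * n div d) - 2 * real (n div d))"
      by (intro mult_nonneg_nonneg mangoldt_nonneg) linarith
  qed auto
  also have "\<dots> = (\<Sum>d=1..2*n. mangoldt d * real (2 * n div d)) - 2 * (\<Sum>d=1..2*n. mangoldt d * real (n div d))"
    by (simp add: sum_subtractf sum_distrib_left algebra_simps)
  also have "\<dots> = ln (fact (2 * n)) - 2 * ln (fact n)"
    unfolding ext[symmetric] sum_mangoldt_div ..
  also have "\<dots> = ln (real (2 * n choose n))"
  proof -
    have "real (2 * n choose n) = fact (2 * n) / (fact n * fact n)"
      using binomial_fact[of n "2 * n", where 'a = real] by simp
    then show ?thesis by (simp add: ln_div ln_mult)
  qed
  also have "\<dots> \<le> ln (2 ^ (2 * n))"
  proof -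
    have "(2 * n choose n) \<le> 2 ^ (2 * n)" by (rule binomial_le_pow2)
    then have "real (2 * n choose n) \<le> 2 ^ (2 * n)" by (metis of_nat_le_iff of_nat_numeral of_nat_power)
    then show ?thesis by (subst ln_le_cancel_iff) auto
  qed
  also have "\<dots> = 2 * real n * ln 2" by (simp add: ln_realpow)
  also have "\<dots> \<le> 2 * real n * 1" using ln_2_less_1 by (intro mult_left_mono) auto
  finally show ?thesis by simp
qed

text \<open>The constant 4 closes the induction by halving: 4n + 2n, plus at most 2n for the extra
  term when N is odd, is 8n <= 4N.\<close>

lemma psi_le: "psi N \<le> 4 * real N"
proof (induction N rule: less_induct)
  case (less N)
  show ?case
  proof (cases "N \<le> 1")
    case True
    then show ?thesis by (cases N) (auto simp: psi_Suc)
  next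
    case False
    define n where "n = N div 2"
    have n: "n < N" "n \<ge> 1" using False by (auto simp: n_def)
    have "N = 2 * n \<or> N = Suc (2 * n)" by (auto simp: n_def)
    then show ?thesis
    proof
      assume N: "N = 2 * n"
      then show ?thesis using psi_double_le[of n] less.IH[OF n(1)] by simp
    next
      assume N: "N = Suc (2 * n)"
      have "mangoldt N \<le> ln (real N)" using mangoldt_le[of N] N by simp
      also have "\<dots> \<le> 2 * real n" using ln_add_one_self_le_self[of "2 * real n"] by (simp add: N add.commute)
      finally show ?thesis using psi_double_le[of n] less.IH[OF n(1)] by (simp add: N psi_Suc)
    qed
  qed
qed

lemma abs_psi_minus_le: "\<bar>psi n - real n\<bar> \<le> 4 * real n"
  using psi_le[of n] psi_nonneg[of n] by (auto simp: abs_le_iff)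

section \<open>The Tauberian theorem applied to psi\<close>

lemma psi_dirichlet_abel_sums:
  assumes s: "Re s > 1"
  shows "(\<lambda>n. of_real (psi n - real n) * (of_nat n powr (- s) - of_nat (Suc n) powr (- s))) sums
    (mangoldt_series s - zeta_series s)"
proof -
  define C where "C = (\<lambda>n. complex_of_real (psi n - real n))"
  \<comment> \<open>At N = 0 the truncated index \<open>N - 1\<close> is 0, and the boundary term
    vanishes because \<open>0 powr w = 0\<close>.\<close>
  have "(\<Sum>n<N. C n * (of_nat n powr (- s) - of_nat (Suc n) powr (- s)))
      = (\<Sum>n<N. mangoldt n * of_nat n powr (- s) - of_nat n powr (- s)) - C (N - 1) * of_nat N powr (- s)" for N
  proof (induction N)
    case (Suc N)
    have step: "C (N - 1) * of_nat N powr (- s) = C N * of_nat N powr (- s) - mangoldt N * of_nat N powr (- s) + of_nat N powr (- s)"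
    proof (cases N)
      case (Suc M)
      have "C N = C M + mangoldt N - 1"
        unfolding C_def Suc psi_Suc by simp
      then have "C (N - 1) = C N - mangoldt N + 1" by (simp add: Suc)
      then show ?thesis by (simp only: left_diff_distrib distrib_right mult_1_left)
    qed simp
    show ?case unfolding sum.lessThan_Suc Suc.IH diff_Suc_1 step by (simp add: algebra_simps)
  qed simp
  moreover have "(\<lambda>N. (\<Sum>n<N. mangoldt n * of_nat n powr (- s) - of_nat n powr (- s)) - C (N - 1) * of_nat N powr (- s))
      \<longlonglongrightarrow> (mangoldt_series s - zeta_series s) - 0"
  proof (rule tendsto_diff)
    have "(\<lambda>n. mangoldt n * of_nat n powr (- s) - of_nat n powr (- s)) sums (mangoldt_series s - zeta_series s)"
      unfolding mangoldt_series_def zeta_series_def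
      by (intro sums_diff summable_sums summable_norm_cancel[OF mangoldt_dirichlet_series(1)[OF s]]
          summable_norm_cancel[OF zeta_dirichlet_series(1)[OF s]])
    then show "(\<lambda>N. \<Sum>n<N. mangoldt n * of_nat n powr (- s) - of_nat n powr (- s)) \<longlonglongrightarrow> mangoldt_series s - zeta_series s"
      by (simp add: sums_def)
    have bound: "norm (C (N - 1) * of_nat N powr (- s)) \<le> 4 * real N powr (1 - Re s)" for N
    proof -
      have "norm (C (N - 1)) \<le> 4 * real (N - 1)"
        unfolding C_def norm_of_real by (rule abs_psi_minus_le)
      also have "\<dots> \<le> 4 * real N" by simp
      finally have "norm (C (N - 1) * of_nat N powr (- s)) \<le> 4 * real N * real N powr (- Re s)"
        unfolding norm_mult norm_of_nat_powr by (simp add: mult_right_mono)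
      also have "\<dots> = 4 * real N powr (1 - Re s)"
        by (cases "N = 0") (auto simp: powr_diff powr_minus divide_inverse)
      finally show ?thesis .
    qed
    have "(\<lambda>N. 4 * real N powr (1 - Re s)) \<longlonglongrightarrow> 0" using s by real_asymp
    then show "(\<lambda>N. C (N - 1) * of_nat N powr (- s)) \<longlonglongrightarrow> 0"
      by (rule Lim_null_comparison[OF always_eventually, rotated]) (intro allI bound)
  qed
  ultimately have "(\<lambda>N. \<Sum>n<N. C n * (of_nat n powr (- s) - of_nat (Suc n) powr (- s))) \<longlonglongrightarrow> mangoldt_series s - zeta_series s"
    by (simp only: diff_zero)
  then show ?thesis by (simp only: sums_def C_def)
qed

text \<open>\<open>E\<close> converts the weights from Abel summation into
  \<open>s n^(-s-1)\<close>. Its series converges for Re s > 0, so the line Re s = 1 is interior to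
  its domain, and dividing by \<open>s\<close> gives the series with coefficients
  \<open>(psi n - n) / n\<close>, bounded by 4.\<close>

lemma convergent_psi_sum:
  "convergent (\<lambda>N. \<Sum>n=1..N. (psi n - real n) / (real n)\<^sup>2)"
proof -
  define c where "c = (\<lambda>n. complex_of_real (psi n - real n))"
  have c: "norm (c n) \<le> 4 * real n powr 1" for n
    unfolding c_def norm_of_real using abs_psi_minus_le[of n] by (cases "n = 0") auto
  define V where "V = {s. Re s > 0} \<inter> zeta1 -` (- {0})"
  have V: "open V" unfolding V_def
    by (intro continuous_open_preimage holomorphic_on_imp_continuous_on zeta1_holomorphic open_halfspace_Re_gt) auto
  define E where "E = (\<lambda>s. \<Sum>n. c n * zeta_term n (s + 1))"
  \<comment> \<open>This is zeta(s) - 1/(s-1) with the singularity at 1 removed. In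
    \<open>- q - zeta1' / zeta1\<close> the poles of zeta and of its logarithmic derivative have
    cancelled, so only zeros of \<open>zeta1\<close> are excluded from \<open>V\<close>.\<close>
  define q where "q = (\<lambda>s. if s = 1 then deriv zeta1 1 else (zeta1 s - zeta1 1) / (s - 1))"
  define G where "G = (\<lambda>s. (E s + (- q s - deriv zeta1 s / zeta1 s)) / s)"
  have holE: "E holomorphic_on {s. Re s > 0}"
  proof -
    have "((\<lambda>s. \<Sum>n. c n * zeta_term n s) \<circ> (\<lambda>s. s + 1)) holomorphic_on {s. Re s > 0}"
      by (rule holomorphic_on_compose_gen[OF _ zeta_term_series_holomorphic(1)[OF c]]) (auto intro!: holomorphic_intros)
    then show ?thesis by (simp add: E_def o_def)
  qed
  have holq: "q holomorphic_on {s. Re s > 0}"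
    unfolding q_def by (rule pole_lemma[OF zeta1_holomorphic]) (simp add: interior_open open_halfspace_Re_gt)
  have holG: "G holomorphic_on V"
    unfolding G_def
    by (intro holomorphic_intros holomorphic_on_subset[OF holE] holomorphic_on_subset[OF holq]
        holomorphic_on_subset[OF holomorphic_deriv[OF zeta1_holomorphic open_halfspace_Re_gt]]
        holomorphic_on_subset[OF zeta1_holomorphic]) (auto simp: V_def)
  have G: "(\<lambda>n. c n / of_nat n * of_nat n powr (- s)) sums G s" if s: "Re s > 1" for s
  proof -
    have s1: "s \<noteq> 1" "s \<noteq> 0" using s by auto
    have H: "- q s - deriv zeta1 s / zeta1 s = mangoldt_series s - zeta_series s"
    proof -
      have "deriv zeta1 s / zeta1 s = 1 / (s - 1) - mangoldt_series s"
        using deriv_zeta1[OF s] zeta1_nonzero_Re_gt_1[OF s] by simp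
      moreover have "q s = zeta_series s - 1 / (s - 1)"
        using s1 by (simp add: q_def zeta1_1 zeta1_eq[OF s] diff_divide_distrib)
      ultimately show ?thesis by simp
    qed
    have "(\<lambda>n. c n * zeta_term n (s + 1)) sums E s"
      unfolding E_def by (intro summable_sums zeta_term_series_holomorphic(2)[OF c]) (use s in auto)
    from sums_add[OF this psi_dirichlet_abel_sums[OF s]]
    have "(\<lambda>n. c n * zeta_term n (s + 1) + c n * (of_nat n powr (- s) - of_nat (Suc n) powr (- s))) sums
        (E s + (- q s - deriv zeta1 s / zeta1 s))"
      unfolding H c_def .
    then have "(\<lambda>n. (c n * zeta_term n (s + 1) + c n * (of_nat n powr (- s) - of_nat (Suc n) powr (- s))) / s) sums G s"
      unfolding G_def by (rule sums_divide)
    moreover have "(c n * zeta_term n (s + 1) + c n * (of_nat n powr (- s) - of_nat (Suc n) powr (- s))) / s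
        = c n / of_nat n * of_nat n powr (- s)" for n
    proof (cases "n = 0")
      case False
      have e: "1 - (s + 1) = - s" "- (s + 1) = - s - 1" "s + 1 - 1 = s" by simp_all
      have "c n * zeta_term n (s + 1) + c n * (of_nat n powr (- s) - of_nat (Suc n) powr (- s)) = c n * (s * of_nat n powr (- s - 1))"
        unfolding zeta_term_def e distrib_left[symmetric] by simp
      then show ?thesis using False s1 by (simp add: powr_diff)
    qed (simp add: c_def)
    ultimately show ?thesis by simp
  qed
  have "(\<lambda>N. \<Sum>n=1..N. (c n / of_nat n) / of_nat n) \<longlonglongrightarrow> (\<lambda>z. G (1 + z)) 0"
  proof (rule newman_tauberian[where B = 4 and U = "(\<lambda>z. 1 + z) -` V"])
    show "norm (c n / of_nat n) \<le> 4" for n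
      using c[of n] by (cases "n = 0") (auto simp: norm_divide divide_simps)
    show "open ((\<lambda>z. 1 + z) -` V)"
      by (intro open_vimage V continuous_intros)
    show "{z. Re z \<ge> 0} \<subseteq> (\<lambda>z. 1 + z) -` V"
      using zeta1_nonzero by (auto simp: V_def)
    have "(G \<circ> (\<lambda>z. 1 + z)) holomorphic_on ((\<lambda>z. 1 + z) -` V)"
      by (rule holomorphic_on_compose_gen[OF _ holG]) (auto intro!: holomorphic_intros)
    then show "(\<lambda>z. G (1 + z)) holomorphic_on ((\<lambda>z. 1 + z) -` V)" by (simp add: o_def)
    fix z :: complex assume "Re z > 0"
    then show "(\<lambda>n. c n / of_nat n * of_nat n powr (- 1 - z)) sums G (1 + z)"
      using G[of "1 + z"] by simp
  qed
  then have "(\<lambda>N. Re (\<Sum>n=1..N. (c n / of_nat n) / of_nat n)) \<longlonglongrightarrow> Re (G (1 + 0))"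
    by (rule tendsto_Re)
  moreover have "Re (\<Sum>n=1..N. (c n / of_nat n) / of_nat n) = (\<Sum>n=1..N. (psi n - real n) / (real n)\<^sup>2)" for N
  proof -
    have "(\<Sum>n=1..N. (c n / of_nat n) / of_nat n) = of_real (\<Sum>n=1..N. (psi n - real n) / (real n)\<^sup>2)"
      by (simp add: c_def power2_eq_square)
    then show ?thesis by simp
  qed
  ultimately show ?thesis by (auto simp: convergent_def)
qed

section \<open>From convergence to asymptotics\<close>

text \<open>Monotonicity makes a deviation persist: if f(N) is too large, f(i) - i stays above dN
  for about dN indices after N; if too small, the same happens before N. Such a block contributes a
  fixed amount to the sum, against the Cauchy criterion.\<close>

lemma mono_asymptotic_if_convergent:
  fixes f :: "nat \<Rightarrow> real"
  assumes mono: "mono f" and conv: "convergent (\<lambda>N. \<Sum>n=1..N. (f n - real n) / (real n)\<^sup>2)"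
  shows "(\<lambda>n. f n / real n) \<longlonglongrightarrow> 1"
proof (rule LIMSEQ_I)
  fix r :: real assume r: "r > 0"
  define e where "e = min r 1"
  define d where "d = e / 2"
  have d: "d > 0" "d \<le> 1 / 2" "e = 2 * d" using r by (auto simp: d_def e_def)
  define S where "S = (\<lambda>N. \<Sum>n=1..N. (f n - real n) / (real n)\<^sup>2)"
  have "Cauchy S" using conv by (simp add: S_def convergent_Cauchy)
  \<comment> \<open>The upper block has at least dN/2 terms, each at least d/(4N); the product is
    \<open>d^2 / 8\<close>. The lower block gives even \<open>d^2 / 2\<close>.\<close>
  moreover have "d\<^sup>2 / 8 > 0" using d by simp
  ultimately have "\<exists>M. \<forall>m\<ge>M. \<forall>n\<ge>M. norm (S m - S n) < d\<^sup>2 / 8" by (rule CauchyD)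
  then obtain N0 where "\<forall>m\<ge>N0. \<forall>n\<ge>N0. norm (S m - S n) < d\<^sup>2 / 8" ..
  then have N0: "\<bar>S m - S n\<bar> < d\<^sup>2 / 8" if "m \<ge> N0" "n \<ge> N0" for m n
    using that by simp
  have diff: "S n - S m = (\<Sum>i\<in>{m<..n}. (f i - real i) / (real i)\<^sup>2)" if "m \<le> n" for m n
  proof -
    have "{1..n} = {1..m} \<union> {m<..n}" using that by auto
    then have "S n = S m + (\<Sum>i\<in>{m<..n}. (f i - real i) / (real i)\<^sup>2)"
      unfolding S_def by (simp only:) (rule sum.union_disjoint, auto)
    then show ?thesis by simp
  qed
  \<comment> \<open>Two conditions on N: \<open>N - k >= N / 2\<close> must still reach
    \<open>N0\<close>, and \<open>d N >= 2\<close> ensures that the floor \<open>k\<close> loses at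
    most half of \<open>d N\<close>.\<close>
  have "\<bar>f N / real N - 1\<bar> < r" if N: "N \<ge> max (2 * N0 + 1) (nat \<lceil>2 / d\<rceil>)" for N
  proof (rule ccontr)
    assume "\<not> \<bar>f N / real N - 1\<bar> < r"
    then have big: "\<bar>f N / real N - 1\<bar> \<ge> e" by (simp add: e_def)
    have Npos: "real N > 0" using N by simp
    have dN: "d * real N \<ge> 2" using N d by (simp add: field_simps nat_ceiling_le_eq)
    have dN0: "0 \<le> x" if "d * real N \<le> x" for x using that dN by linarith
    define k where "k = nat \<lfloor>d * real N\<rfloor>"
    have k: "real k \<le> d * real N" "real k \<ge> d * real N / 2"
      using dN unfolding k_def by linarith+
    have kN: "2 * k \<le> N"
    proof -
      have "d * real N \<le> 1 / 2 * real N" using d by (intro mult_right_mono) auto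
      then show ?thesis using k by linarith
    qed
    have "f N \<ge> (1 + e) * real N \<or> f N \<le> (1 - e) * real N"
      using big Npos by (auto simp: abs_if field_simps split: if_splits)
    then show False
    proof
      assume fN: "f N \<ge> (1 + e) * real N"
      have "real k * (d / (4 * real N)) = (\<Sum>i\<in>{N<..N+k}. d / (4 * real N))" by simp
      also have "\<dots> \<le> (\<Sum>i\<in>{N<..N+k}. (f i - real i) / (real i)\<^sup>2)"
      proof (rule sum_mono)
        fix i assume i: "i \<in> {N<..N+k}"
        have "f N \<le> f i" using i mono by (auto simp: mono_def)
        then have a: "f i - real i \<ge> d * real N" using fN i k d(3) by (auto simp: algebra_simps)
        have "real i \<le> 2 * real N" using i kN by auto
        then have "(real i)\<^sup>2 \<le> (2 * real N)\<^sup>2" by (intro power_mono) auto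
        then have "d * real N / (2 * real N)\<^sup>2 \<le> (f i - real i) / (real i)\<^sup>2"
          using a dN0[OF a] Npos i by (intro frac_le) auto
        then show "d / (4 * real N) \<le> (f i - real i) / (real i)\<^sup>2"
          using Npos by (simp add: power2_eq_square)
      qed
      also have "\<dots> = S (N + k) - S N" by (rule diff[symmetric]) simp
      also have "\<dots> < d\<^sup>2 / 8" using N0[of "N + k" N] N by linarith
      finally have "real k * (d / (4 * real N)) < d\<^sup>2 / 8" .
      moreover have "d * real N / 2 * (d / (4 * real N)) \<le> real k * (d / (4 * real N))"
        using k d Npos by (intro mult_right_mono) auto
      ultimately show False using Npos by (simp add: power2_eq_square)
    next
      assume fN: "f N \<le> (1 - e) * real N"
      have "S N - S (N - k) = (\<Sum>i\<in>{N-k<..N}. (f i - real i) / (real i)\<^sup>2)" by (rule diff) simp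
      also have "\<dots> \<le> (\<Sum>i\<in>{N-k<..N}. - (d / real N))"
      proof (rule sum_mono)
        fix i assume i: "i \<in> {N-k<..N}"
        have "f i \<le> f N" using i mono by (auto simp: mono_def)
        moreover have "real i \<ge> real N - real k" using i kN by auto
        ultimately have a: "real i - f i \<ge> d * real N" using fN k d(3) by (auto simp: algebra_simps)
        have "(real i)\<^sup>2 \<le> (real N)\<^sup>2" using i by (intro power_mono) auto
        then have "d * real N / (real N)\<^sup>2 \<le> (real i - f i) / (real i)\<^sup>2"
          using a dN0[OF a] Npos i by (intro frac_le) auto
        then have "d / real N \<le> - ((f i - real i) / (real i)\<^sup>2)"
          using Npos by (simp add: power2_eq_square minus_divide_left)
        then show "(f i - real i) / (real i)\<^sup>2 \<le> - (d / real N)" by simp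
      qed
      also have "\<dots> = - (real k * (d / real N))" using kN by simp
      finally have "real k * (d / real N) \<le> S (N - k) - S N" by simp
      also have "\<dots> < d\<^sup>2 / 8" using N0[of "N - k" N] N kN by linarith
      finally have "real k * (d / real N) < d\<^sup>2 / 8" .
      moreover have "d * real N / 2 * (d / real N) \<le> real k * (d / real N)"
        using k d Npos by (intro mult_right_mono) auto
      moreover have "d * real N / 2 * (d / real N) = d\<^sup>2 / 2" using Npos by (simp add: power2_eq_square)
      moreover have "d\<^sup>2 > 0" using d by simp
      ultimately show False by linarith
    qed
  qed
  then show "\<exists>no. \<forall>n\<ge>no. norm (f n / real n - 1) < r"
    unfolding real_norm_def by blast
qed

theorem psi_asymptotic: "(\<lambda>n. psi n / real n) \<longlonglongrightarrow> 1"
  by (intro mono_asymptotic_if_convergent convergent_psi_sum) (auto simp: mono_def psi_mono)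

section \<open>Counting pairs of odd primes\<close>

definition odd_primes_upto :: "nat \<Rightarrow> nat set" where
  "odd_primes_upto N = {p. prime p \<and> odd p \<and> p \<le> N}"

lemma finite_odd_primes_upto [simp]: "finite (odd_primes_upto N)"
  unfolding odd_primes_upto_def by (rule finite_subset[of _ "{..N}"]) auto

lemma card_prime_powers_le:
  assumes p: "prime p" and N: "N \<ge> 1"
  shows "real (card {n \<in> {1..N}. primepow n \<and> aprimedivisor n = p}) * ln (real p) \<le> ln (real N)"
proof -
  define K where "K = nat \<lfloor>log (real p) (real N)\<rfloor>"
  have p1: "real p > 1" using prime_gt_1_nat[OF p] by simp
  have log0: "log (real p) (real N) \<ge> 0" using p1 N by simp
  have "{n \<in> {1..N}. primepow n \<and> aprimedivisor n = p} \<subseteq> (\<lambda>k. p ^ k) ` {1..K}"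
  proof
    fix n assume "n \<in> {n \<in> {1..N}. primepow n \<and> aprimedivisor n = p}"
    then have n: "n \<le> N" "n \<ge> 1" "primepow n" "aprimedivisor n = p" by auto
    define k where "k = multiplicity p n"
    have nk: "n = p ^ k" using primepow_decompose[OF n(3)] n(4) by (simp add: k_def)
    have "k \<noteq> 0" using n(3) nk by (intro notI) auto
    moreover have "real k \<le> log (real p) (real N)"
    proof -
      have "real p ^ k \<le> real N" using n(1) nk by (metis of_nat_le_iff of_nat_power)
      then have "log (real p) (real p ^ k) \<le> log (real p) (real N)"
        using p1 N by (subst log_le_cancel_iff) auto
      then show ?thesis using p1 by (simp add: log_nat_power)
    qed
    ultimately have "k \<in> {1..K}" unfolding K_def by (auto simp: le_nat_iff le_floor_iff)
    then show "n \<in> (\<lambda>k. p ^ k) ` {1..K}" using nk by blast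
  qed
  then have "card {n \<in> {1..N}. primepow n \<and> aprimedivisor n = p} \<le> card ((\<lambda>k. p ^ k) ` {1..K})"
    by (intro card_mono) auto
  also have "\<dots> \<le> K" using card_image_le[of "{1..K}" "\<lambda>k. p ^ k"] by simp
  finally have "real (card {n \<in> {1..N}. primepow n \<and> aprimedivisor n = p}) \<le> real K" by simp
  also have "\<dots> \<le> log (real p) (real N)" using log0 by (simp add: K_def)
  finally show ?thesis using p1 by (simp add: log_def field_simps)
qed

text \<open>Grouping psi by the underlying prime, each prime contributes at most ln N through all
  its powers. The summand 1 accounts for the prime 2.\<close>

lemma psi_le_card_odd_primes:
  assumes N: "N \<ge> 1"
  shows "psi N \<le> (real (card (odd_primes_upto N)) + 1) * ln (real N)"
proof -
  let ?A = "{n \<in> {1..N}. primepow n}" and ?T = "insert 2 (odd_primes_upto N)"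
  have sub: "aprimedivisor ` ?A \<subseteq> ?T"
  proof
    fix p assume "p \<in> aprimedivisor ` ?A"
    then obtain n where n: "n \<le> N" "primepow n" "p = aprimedivisor n" by auto
    have n1: "n > 1" using primepow_gt_Suc_0[OF n(2)] by simp
    have "prime p" using n1 unfolding n(3) by (intro prime_aprimedivisor') auto
    moreover have "p \<le> N" using n1 n aprimedivisor_le_nat[of n] by simp
    moreover have "p = 2 \<or> odd p" using \<open>prime p\<close> by (metis primes_dvd_imp_eq two_is_prime_nat)
    ultimately show "p \<in> ?T" by (auto simp: odd_primes_upto_def)
  qed
  have "psi N = (\<Sum>n\<in>?A. ln (real (aprimedivisor n)))"
    unfolding psi_def by (intro sum.mono_neutral_cong_right) (auto simp: mangoldt_def)
  also have "\<dots> = (\<Sum>p\<in>?T. \<Sum>n\<in>{n \<in> ?A. aprimedivisor n = p}. ln (real (aprimedivisor n)))"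
    by (rule sum.group[symmetric]) (use sub in auto)
  also have "\<dots> \<le> (\<Sum>p\<in>?T. ln (real N))"
  proof (rule sum_mono)
    fix p assume p: "p \<in> ?T"
    have "(\<Sum>n\<in>{n \<in> ?A. aprimedivisor n = p}. ln (real (aprimedivisor n))) = (\<Sum>n\<in>{n \<in> ?A. aprimedivisor n = p}. ln (real p))"
      by (rule sum.cong) auto
    also have "\<dots> = real (card {n \<in> ?A. aprimedivisor n = p}) * ln (real p)" by simp
    also have "\<dots> = real (card {n \<in> {1..N}. primepow n \<and> aprimedivisor n = p}) * ln (real p)"
      by (rule arg_cong[where f = "\<lambda>A. real (card A) * ln (real p)"]) auto
    also have "\<dots> \<le> ln (real N)"
      using p by (intro card_prime_powers_le N) (auto simp: odd_primes_upto_def)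
    finally show "(\<Sum>n\<in>{n \<in> ?A. aprimedivisor n = p}. ln (real (aprimedivisor n))) \<le> ln (real N)" .
  qed
  also have "\<dots> = real (card ?T) * ln (real N)" by simp
  also have "\<dots> \<le> (real (card (odd_primes_upto N)) + 1) * ln (real N)"
    using N by (intro mult_right_mono) (auto simp: card_insert_if)
  finally show ?thesis .
qed

text \<open>Primes up to \<open>M powr a\<close> are counted trivially; each larger one contributes
  at least \<open>a * ln M\<close> to psi. The cut depends on M and not on y, to give a bound
  uniform in y.\<close>

lemma card_odd_primes_le:
  assumes a: "a > 0" and M: "M \<ge> 2"
  shows "real (card (odd_primes_upto y)) \<le> real M powr a + psi y / (a * ln (real M))"
proof -
  let ?S = "{p \<in> odd_primes_upto y. real p \<le> real M powr a}"
  let ?B = "{p \<in> odd_primes_upto y. real p > real M powr a}"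
  have L: "a * ln (real M) > 0" using a M by simp
  have "odd_primes_upto y = ?S \<union> ?B" by auto
  then have "card (odd_primes_upto y) \<le> card ?S + card ?B" by (metis (lifting) card_Un_le)
  then have "real (card (odd_primes_upto y)) \<le> real (card ?S) + real (card ?B)" by linarith
  moreover have "real (card ?S) \<le> real M powr a"
  proof -
    have "?S \<subseteq> {1..nat \<lfloor>real M powr a\<rfloor>}"
      by (auto simp: odd_primes_upto_def le_nat_iff le_floor_iff dest: prime_gt_0_nat)
    then have "card ?S \<le> card {1..nat \<lfloor>real M powr a\<rfloor>}" by (intro card_mono) auto
    then have "real (card ?S) \<le> real (nat \<lfloor>real M powr a\<rfloor>)" unfolding of_nat_le_iff by simp
    also have "\<dots> \<le> real M powr a" by simp
    finally show ?thesis .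
  qed
  moreover have "real (card ?B) * (a * ln (real M)) \<le> psi y"
  proof -
    have "real (card ?B) * (a * ln (real M)) = (\<Sum>p\<in>?B. a * ln (real M))" by simp
    also have "\<dots> \<le> (\<Sum>p\<in>?B. mangoldt p)"
    proof (rule sum_mono)
      fix p assume p: "p \<in> ?B"
      then have "0 < real M powr a" "real M powr a < real p" using M by auto
      then have "ln (real M powr a) \<le> ln (real p)" by (subst ln_le_cancel_iff) linarith+
      then show "a * ln (real M) \<le> mangoldt p" using p M by (simp add: odd_primes_upto_def ln_powr)
    qed
    also have "\<dots> \<le> psi y" unfolding psi_def
      by (rule sum_mono2) (auto simp: odd_primes_upto_def mangoldt_nonneg Suc_le_eq dest: prime_gt_0_nat)
    finally show ?thesis .
  qed
  then have "real (card ?B) \<le> psi y / (a * ln (real M))" using L by (simp add: field_simps)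
  ultimately show ?thesis by linarith
qed

text \<open>For y below the threshold of the limit, the Chebyshev bound leaves an error bounded
  independently of M, which \<open>d * M\<close> absorbs once M is large.\<close>

lemma psi_uniform:
  assumes d: "d > 0"
  shows "\<forall>\<^sub>F M in sequentially. \<forall>y\<le>M. \<bar>psi y - real y\<bar> \<le> d * real M"
proof -
  obtain Y where Y: "\<And>y. y \<ge> Y \<Longrightarrow> norm (psi y / real y - 1) < d"
    using LIMSEQ_D[OF psi_asymptotic d] by blast
  have "\<forall>\<^sub>F M in sequentially. real M \<ge> 4 * real Y / d" by real_asymp
  then show ?thesis
  proof (eventually_elim, intro allI impI)
    fix M y :: nat assume M: "real M \<ge> 4 * real Y / d" and y: "y \<le> M"
    show "\<bar>psi y - real y\<bar> \<le> d * real M"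
    proof (cases "y \<ge> Y \<and> y > 0")
      case True
      have "psi y - real y = (psi y / real y - 1) * real y" using True by (simp add: field_simps)
      then have "\<bar>psi y - real y\<bar> = \<bar>psi y / real y - 1\<bar> * real y" by (simp add: abs_mult)
      also have "\<dots> \<le> d * real M" using Y[of y] True y d by (intro mult_mono) auto
      finally show ?thesis .
    next
      case False
      then have "\<bar>psi y - real y\<bar> \<le> 4 * real Y" using abs_psi_minus_le[of y] by auto
      also have "\<dots> \<le> d * real M" using M d by (simp add: field_simps)
      finally show ?thesis .
    qed
  qed
qed

lemma card_odd_primes_uniform:
  assumes e: "e > 0"
  shows "\<forall>\<^sub>F M in sequentially. \<forall>y\<le>M. \<bar>real (card (odd_primes_upto y)) * ln (real M) - real y\<bar> \<le> e * real M"
proof -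
  \<comment> \<open>The upper bound collects four errors of size at most \<open>d * M\<close>: the
    small primes, the factor \<open>1 / a = 1 + d\<close> on y, the error of psi, and the product of
    the last two.\<close>
  define d where "d = min 1 (e / 4)"
  have d: "d > 0" "d \<le> 1" "4 * d \<le> e" using e by (auto simp: d_def)
  define a where "a = 1 / (1 + d)"
  have a: "a > 0" "a < 1" "1 / a = 1 + d" using d by (auto simp: a_def)
  have "\<forall>\<^sub>F M in sequentially. real M powr a * ln (real M) \<le> d * real M" using a d by real_asymp
  moreover have "\<forall>\<^sub>F M in sequentially. ln (real M) \<le> d * real M" using d by real_asymp
  ultimately show ?thesis
    using psi_uniform[OF d(1)] eventually_ge_at_top[of 2]
  proof (eventually_elim, intro allI impI)
    fix M y :: nat
    assume M1: "real M powr a * ln (real M) \<le> d * real M" and M2: "ln (real M) \<le> d * real M"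
      and psi: "\<forall>y\<le>M. \<bar>psi y - real y\<bar> \<le> d * real M" and M: "M \<ge> 2" and y: "y \<le> M"
    let ?P = "real (card (odd_primes_upto y))"
    have L: "ln (real M) > 0" using M by simp
    have psi_y: "\<bar>psi y - real y\<bar> \<le> d * real M" using psi y by blast
    have "?P * ln (real M) \<le> (real M powr a + psi y / (a * ln (real M))) * ln (real M)"
      using card_odd_primes_le[OF a(1) M, of y] L by (intro mult_right_mono) auto
    also have "\<dots> = real M powr a * ln (real M) + (1 / a) * psi y"
      using L a by (simp add: field_simps)
    also have "\<dots> \<le> d * real M + (1 + d) * (real y + d * real M)"
      unfolding a(3) using psi_y d M1 by (intro add_mono mult_left_mono) auto
    also have "\<dots> = real y + d * real M + d * real y + d * real M + d * (d * real M)"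
      by (simp add: algebra_simps)
    also have "\<dots> \<le> real y + d * real M + d * real M + d * real M + 1 * (d * real M)"
      using y d by (intro add_mono mult_left_mono mult_right_mono) auto
    also have "\<dots> \<le> real y + e * real M"
      using mult_right_mono[OF d(3), of "real M"] by simp
    finally have up: "?P * ln (real M) \<le> real y + e * real M" .
    have low: "?P * ln (real M) \<ge> real y - e * real M"
    proof (cases "y = 0")
      case True
      have "0 \<le> ?P * ln (real M)" "0 \<le> e * real M" using L e by simp_all
      then show ?thesis using True by linarith
    next
      case False
      have "psi y \<le> (?P + 1) * ln (real y)" using psi_le_card_odd_primes[of y] False by simp
      also have "\<dots> \<le> (?P + 1) * ln (real M)" using y False by (intro mult_left_mono) auto
      finally have "?P * ln (real M) \<ge> psi y - ln (real M)" by (simp add: algebra_simps)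
      moreover have "2 * d * real M \<le> e * real M" using d by (intro mult_right_mono) auto
      ultimately show ?thesis using psi_y M2 by linarith
    qed
    show "\<bar>?P * ln (real M) - real y\<bar> \<le> e * real M" using up low by (simp add: abs_le_iff)
  qed
qed

section \<open>Ordered pairs of odd primes\<close>

definition odd_prime_pairs :: "nat \<Rightarrow> (nat \<times> nat) set" where
  "odd_prime_pairs M = {(p, q). prime p \<and> odd p \<and> prime q \<and> odd q \<and> p + q \<le> M}"

lemma odd_prime_pairs_eq: "odd_prime_pairs M = Sigma (odd_primes_upto M) (\<lambda>p. odd_primes_upto (M - p))"
  unfolding odd_prime_pairs_def odd_primes_upto_def by auto

lemma finite_odd_prime_pairs [simp]: "finite (odd_prime_pairs M)"
  unfolding odd_prime_pairs_eq by auto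

lemma card_odd_prime_pairs: "card (odd_prime_pairs M) = (\<Sum>p\<in>odd_primes_upto M. card (odd_primes_upto (M - p)))"
  unfolding odd_prime_pairs_eq by (rule card_SigmaI) auto

text \<open>Both sides count pairs of an odd prime p and an integer m with p <= m < M. This serves
  as partial summation and opens the way to the second use of the uniform estimate.\<close>

lemma sum_diff_odd_primes:
  "(\<Sum>p\<in>odd_primes_upto M. M - p) = (\<Sum>m<M. card (odd_primes_upto m))"
proof -
  have "(\<Sum>p\<in>odd_primes_upto M. M - p) = card (Sigma (odd_primes_upto M) (\<lambda>p. {p..<M}))"
    by (subst card_SigmaI) auto
  also have "\<dots> = card (Sigma {..<M} odd_primes_upto)"
    by (rule bij_betw_same_card[of prod.swap])
       (auto simp: bij_betw_def inj_on_def odd_primes_upto_def image_iff)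
  also have "\<dots> = (\<Sum>m<M. card (odd_primes_upto m))"
    by (subst card_SigmaI) auto
  finally show ?thesis .
qed

lemma card_odd_prime_pairs_asymptotic:
  "(\<lambda>M. real (card (odd_prime_pairs M)) * (ln (real M))\<^sup>2 / (real M)\<^sup>2) \<longlonglongrightarrow> 1 / 2"
proof (rule LIMSEQ_I)
  fix r :: real assume r: "r > 0"
  \<comment> \<open>The errors relative to M^2 are 2e for the first insertion, where the number of
    primes times ln M is at most 2M, then e for the second and e for the triangular numbers.\<close>
  define e where "e = min 1 (r / 5)"
  have e: "e > 0" "e \<le> 1" "5 * e \<le> r" using r by (auto simp: e_def)
  have "\<forall>\<^sub>F M in sequentially. real M / 2 \<le> e * (real M)\<^sup>2" using e by real_asymp
  then have "\<forall>\<^sub>F M in sequentially. norm (real (card (odd_prime_pairs M)) * (ln (real M))\<^sup>2 / (real M)\<^sup>2 - 1 / 2) < r"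
    using card_odd_primes_uniform[OF e(1)] eventually_ge_at_top[of 2]
  proof eventually_elim
    case (elim M)
    define P where "P = (\<lambda>y. real (card (odd_primes_upto y)))"
    define l where "l = ln (real M)"
    define R where "R = real M"
    have R: "R > 0" using elim by (simp add: R_def)
    have l: "l > 0" using elim by (simp add: l_def)
    have P: "\<bar>P y * l - real y\<bar> \<le> e * R" if "y \<le> M" for y using elim that by (simp add: P_def l_def R_def)
    have PM: "P M * l \<le> 2 * R"
    proof -
      have "P M * l \<le> R + e * R" using P[of M] by (simp add: abs_le_iff R_def)
      also have "\<dots> \<le> R + 1 * R" using e R by (intro add_left_mono mult_right_mono) auto
      finally show ?thesis by simp
    qed
    have pairs: "real (card (odd_prime_pairs M)) = (\<Sum>p\<in>odd_primes_upto M. P (M - p))"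
      by (simp add: card_odd_prime_pairs P_def)
    have "\<bar>real (card (odd_prime_pairs M)) * l - (\<Sum>p\<in>odd_primes_upto M. real (M - p))\<bar>
        = \<bar>\<Sum>p\<in>odd_primes_upto M. P (M - p) * l - real (M - p)\<bar>"
      unfolding pairs by (simp add: sum_distrib_right sum_subtractf)
    also have "\<dots> \<le> (\<Sum>p\<in>odd_primes_upto M. \<bar>P (M - p) * l - real (M - p)\<bar>)" by (rule sum_abs)
    also have "\<dots> \<le> (\<Sum>p\<in>odd_primes_upto M. e * R)" by (intro sum_mono P) simp
    also have "\<dots> = P M * (e * R)" by (simp add: P_def)
    finally have 1: "\<bar>real (card (odd_prime_pairs M)) * l - (\<Sum>p\<in>odd_primes_upto M. real (M - p))\<bar> \<le> P M * (e * R)" .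
    have "(\<Sum>p\<in>odd_primes_upto M. real (M - p)) = (\<Sum>m<M. P m)"
      using arg_cong[OF sum_diff_odd_primes[of M], of real] by (simp add: P_def)
    with 1 have "\<bar>real (card (odd_prime_pairs M)) * l - (\<Sum>m<M. P m)\<bar> * l \<le> P M * (e * R) * l"
      using l by (intro mult_right_mono) auto
    also have "P M * (e * R) * l = (P M * l) * (e * R)" by simp
    also have "\<dots> \<le> 2 * R * (e * R)" using PM e R by (intro mult_right_mono) auto
    also have "\<bar>real (card (odd_prime_pairs M)) * l - (\<Sum>m<M. P m)\<bar> * l =
        \<bar>real (card (odd_prime_pairs M)) * l\<^sup>2 - (\<Sum>m<M. P m) * l\<bar>"
    proof -
      have "\<bar>x\<bar> * l = \<bar>x * l\<bar>" for x using l by (simp add: abs_mult)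
      then show ?thesis by (simp only: left_diff_distrib power2_eq_square mult.assoc)
    qed
    finally have 2: "\<bar>real (card (odd_prime_pairs M)) * l\<^sup>2 - (\<Sum>m<M. P m) * l\<bar> \<le> 2 * e * R\<^sup>2"
      by (simp add: power2_eq_square algebra_simps)
    have "\<bar>(\<Sum>m<M. P m) * l - (\<Sum>m<M. real m)\<bar> = \<bar>\<Sum>m<M. P m * l - real m\<bar>"
      by (simp add: sum_distrib_right sum_subtractf)
    also have "\<dots> \<le> (\<Sum>m<M. \<bar>P m * l - real m\<bar>)" by (rule sum_abs)
    also have "\<dots> \<le> (\<Sum>m<M. e * R)" by (intro sum_mono P) simp
    also have "\<dots> = e * R\<^sup>2" by (simp add: R_def power2_eq_square)
    finally have 3: "\<bar>(\<Sum>m<M. P m) * l - (\<Sum>m<M. real m)\<bar> \<le> e * R\<^sup>2" .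
    have gauss: "(\<Sum>m<N. real m) = (real N)\<^sup>2 / 2 - real N / 2" for N
      by (induction N) (auto simp: power2_eq_square field_simps)
    have 4: "\<bar>(\<Sum>m<M. real m) - R\<^sup>2 / 2\<bar> \<le> e * R\<^sup>2"
      unfolding gauss using elim(1) by (simp add: R_def)
    have "\<bar>real (card (odd_prime_pairs M)) * l\<^sup>2 - R\<^sup>2 / 2\<bar> \<le> 4 * e * R\<^sup>2"
      using 2 3 4 by linarith
    then have "\<bar>real (card (odd_prime_pairs M)) * l\<^sup>2 - R\<^sup>2 / 2\<bar> / R\<^sup>2 \<le> 4 * e"
      using R by (simp add: field_simps)
    moreover have "\<bar>real (card (odd_prime_pairs M)) * l\<^sup>2 - R\<^sup>2 / 2\<bar> / R\<^sup>2 =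
        \<bar>real (card (odd_prime_pairs M)) * l\<^sup>2 / R\<^sup>2 - 1 / 2\<bar>"
    proof -
      have "real (card (odd_prime_pairs M)) * l\<^sup>2 / R\<^sup>2 - 1 / 2 = (real (card (odd_prime_pairs M)) * l\<^sup>2 - R\<^sup>2 / 2) / R\<^sup>2"
        using R by (simp add: diff_divide_distrib)
      then show ?thesis by simp
    qed
    ultimately show ?case using e unfolding l_def R_def real_norm_def by linarith
  qed
  then show "\<exists>no. \<forall>M\<ge>no. norm (real (card (odd_prime_pairs M)) * (ln (real M))\<^sup>2 / (real M)\<^sup>2 - 1 / 2) < r"
    by (simp add: eventually_sequentially)
qed

section \<open>Partitions as unordered pairs\<close>

text \<open>Odd primes are at least 3, so their sums are even and exceed 4 automatically; the union
  over sizes collapses to the single condition \<open>p + q <= m\<close>.\<close>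

lemma Sigma_part_eq: "Sigma_part m = (\<lambda>(p, q). {#p, q#}) ` odd_prime_pairs m"
proof -
  have "p + q > 4 \<and> even (p + q)" if "prime p" "odd p" "prime q" "odd q" for p q :: nat
  proof -
    have "p \<noteq> 2" "q \<noteq> 2" using that by auto
    then have "p > 2" "q > 2" using that prime_ge_2_nat[of p] prime_ge_2_nat[of q] by auto
    then show ?thesis using that by auto
  qed
  note sum_gt = this
  show ?thesis
  proof (intro equalityI subsetI)
    fix P assume "P \<in> Sigma_part m"
    then obtain p q where "P = {#p, q#}" "prime p" "odd p" "prime q" "odd q" "p + q \<le> m"
      unfolding Sigma_part_def odd_prime_partitions_def by auto
    then show "P \<in> (\<lambda>(p, q). {#p, q#}) ` odd_prime_pairs m"
      by (intro image_eqI[of _ _ "(p, q)"]) (auto simp: odd_prime_pairs_def)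
  next
    fix P assume "P \<in> (\<lambda>(p, q). {#p, q#}) ` odd_prime_pairs m"
    then obtain p q where pq: "P = {#p, q#}" "prime p" "odd p" "prime q" "odd q" "p + q \<le> m"
      unfolding odd_prime_pairs_def by auto
    then have "p + q \<in> {N \<in> {4<..m}. even N}" using sum_gt[of p q] by simp
    moreover have "P \<in> odd_prime_partitions (p + q)"
      using pq unfolding odd_prime_partitions_def by blast
    ultimately show "P \<in> Sigma_part m" unfolding Sigma_part_def by blast
  qed
qed

text \<open>Every unordered pair has exactly one ordering with p <= q, and swapping matches p < q
  with q < p. Hence twice the number of partitions exceeds the number of ordered pairs by the size
  of the diagonal, which is at most m.\<close>

lemma card_Sigma_part_bounds:
  "card (odd_prime_pairs m) \<le> 2 * card (Sigma_part m)"
  "2 * card (Sigma_part m) \<le> card (odd_prime_pairs m) + m"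
proof -
  let ?O = "odd_prime_pairs m"
  let ?f = "\<lambda>(p, q). {#p, q#} :: nat multiset"
  let ?le = "{(p, q) \<in> ?O. p \<le> q}" and ?gt = "{(p, q) \<in> ?O. q < p}"
  let ?lt = "{(p, q) \<in> ?O. p < q}" and ?eq = "{(p, q) \<in> ?O. p = q}"
  have fin: "finite ?le" "finite ?gt" "finite ?lt" "finite ?eq"
    by (auto intro: finite_subset[OF _ finite_odd_prime_pairs[of m]])
  have "Sigma_part m = ?f ` ?le"
  proof
    show "Sigma_part m \<subseteq> ?f ` ?le"
    proof
      fix P assume "P \<in> Sigma_part m"
      then obtain p q where pq: "P = {#p, q#}" "(p, q) \<in> ?O" unfolding Sigma_part_eq by auto
      then have sw: "P = {#q, p#}" "(q, p) \<in> ?O" by (auto simp: odd_prime_pairs_def add_mset_commute add.commute)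
      show "P \<in> ?f ` ?le"
      proof (cases "p \<le> q")
        case True
        then show ?thesis using pq by (intro image_eqI[of _ _ "(p, q)"]) auto
      next
        case False
        then show ?thesis using sw by (intro image_eqI[of _ _ "(q, p)"]) auto
      qed
    qed
    show "?f ` ?le \<subseteq> Sigma_part m" unfolding Sigma_part_eq by auto
  qed
  moreover have "inj_on ?f ?le"
    by (auto simp: inj_on_def add_eq_conv_ex add_mset_eq_single)
  ultimately have S: "card (Sigma_part m) = card ?le" by (simp add: card_image)
  have "?O = ?le \<union> ?gt" by auto
  then have O: "card ?O = card ?le + card ?gt"
    using fin by (subst (1) \<open>?O = ?le \<union> ?gt\<close>) (rule card_Un_disjoint, auto)
  have gt: "card ?gt = card ?lt"
    by (rule bij_betw_same_card[of prod.swap])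
       (auto simp: bij_betw_def inj_on_def odd_prime_pairs_def image_iff add.commute)
  have "?le = ?lt \<union> ?eq" by auto
  then have le: "card ?le = card ?lt + card ?eq"
    using fin by (simp only:) (rule card_Un_disjoint, auto)
  have "card ?eq \<le> card ((\<lambda>p. (p, p)) ` {1..m})"
    by (rule card_mono) (auto simp: odd_prime_pairs_def Suc_le_eq dest: prime_gt_0_nat)
  also have "\<dots> \<le> m" using card_image_le[of "{1..m}" "\<lambda>p. (p, p)"] by simp
  finally have eq: "card ?eq \<le> m" .
  show "card ?O \<le> 2 * card (Sigma_part m)" "2 * card (Sigma_part m) \<le> card ?O + m"
    using S O gt le eq by linarith+
qed

lemma card_Sigma_part_asymptotic:
  "(\<lambda>m. real (card (Sigma_part m)) * (ln (real m))\<^sup>2 / (real m)\<^sup>2) \<longlonglongrightarrow> 1 / 4"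
proof -
  let ?o = "\<lambda>m. real (card (odd_prime_pairs m)) * (ln (real m))\<^sup>2 / (real m)\<^sup>2"
  have up: "(\<lambda>m. 1 / 2 * ?o m + (ln (real m))\<^sup>2 / real m) \<longlonglongrightarrow> 1 / 2 * (1 / 2) + 0"
    by (intro tendsto_add tendsto_mult tendsto_const card_odd_prime_pairs_asymptotic) real_asymp
  have low: "(\<lambda>m. 1 / 2 * ?o m) \<longlonglongrightarrow> 1 / 2 * (1 / 2)"
    by (intro tendsto_mult tendsto_const card_odd_prime_pairs_asymptotic)
  show ?thesis
  proof (rule tendsto_sandwich)
    show "(\<lambda>m. 1 / 2 * ?o m) \<longlonglongrightarrow> 1 / 4" using low by simp
    show "(\<lambda>m. 1 / 2 * ?o m + (ln (real m))\<^sup>2 / real m) \<longlonglongrightarrow> 1 / 4" using up by simp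
    show "\<forall>\<^sub>F m in sequentially. 1 / 2 * ?o m \<le> real (card (Sigma_part m)) * (ln (real m))\<^sup>2 / (real m)\<^sup>2"
    proof (rule always_eventually, intro allI)
      fix m
      have "1 / 2 * real (card (odd_prime_pairs m)) \<le> real (card (Sigma_part m))"
        using card_Sigma_part_bounds(1)[of m] by linarith
      then have "1 / 2 * real (card (odd_prime_pairs m)) * (ln (real m))\<^sup>2 / (real m)\<^sup>2 \<le> real (card (Sigma_part m)) * (ln (real m))\<^sup>2 / (real m)\<^sup>2"
        by (intro divide_right_mono mult_right_mono) auto
      then show "1 / 2 * ?o m \<le> real (card (Sigma_part m)) * (ln (real m))\<^sup>2 / (real m)\<^sup>2" by simp
    qed
    show "\<forall>\<^sub>F m in sequentially. real (card (Sigma_part m)) * (ln (real m))\<^sup>2 / (real m)\<^sup>2 \<le> 1 / 2 * ?o m + (ln (real m))\<^sup>2 / real m"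
    proof (rule eventually_mono[OF eventually_gt_at_top[of 0]])
      fix m :: nat assume m: "m > 0"
      have "real (card (Sigma_part m)) \<le> 1 / 2 * real (card (odd_prime_pairs m)) + real m"
        using card_Sigma_part_bounds(2)[of m] by linarith
      then have "real (card (Sigma_part m)) * (ln (real m))\<^sup>2 / (real m)\<^sup>2 \<le> (1 / 2 * real (card (odd_prime_pairs m)) + real m) * (ln (real m))\<^sup>2 / (real m)\<^sup>2"
        by (intro divide_right_mono mult_right_mono) auto
      also have "\<dots> = 1 / 2 * ?o m + (ln (real m))\<^sup>2 / real m"
        using m by (simp add: power2_eq_square distrib_right add_divide_distrib)
      finally show "real (card (Sigma_part m)) * (ln (real m))\<^sup>2 / (real m)\<^sup>2 \<le> 1 / 2 * ?o m + (ln (real m))\<^sup>2 / real m" .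
    qed
  qed
qed

section \<open>The limit law\<close>

text \<open>Sizes are even, so the half size is an integer j, and j <= un means j <= floor(un). The
  event is therefore itself a set of the form \<open>Sigma_part\<close>.\<close>

lemma Sigma_part_half_size_le:
  assumes u: "0 < u" "u < 1" and n: "n > 0"
  shows "Sigma_part (2 * n) \<inter> {P. half_size P / real n \<le> u} = Sigma_part (2 * nat \<lfloor>u * real n\<rfloor>)"
proof -
  let ?k = "nat \<lfloor>u * real n\<rfloor>"
  have "u * real n \<le> 1 * real n" using u by (intro mult_right_mono) auto
  then have kn: "?k \<le> n" by (simp add: nat_le_iff floor_le_iff)
  have key: "real j / real n \<le> u \<longleftrightarrow> j \<le> ?k" for j :: nat
  proof -
    have "real j / real n \<le> u \<longleftrightarrow> real j \<le> u * real n" using n by (simp add: field_simps)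
    also have "\<dots> \<longleftrightarrow> j \<le> ?k" using u n by (simp add: le_nat_iff le_floor_iff)
    finally show ?thesis .
  qed
  have half: "half_size P / real n \<le> u \<longleftrightarrow> N \<le> 2 * ?k" if P: "P \<in> odd_prime_partitions N" and N: "even N" for P N
  proof -
    obtain j where j: "N = 2 * j" using N by blast
    have "\<Sum>\<^sub># P = N" using P by (auto simp: odd_prime_partitions_def)
    then have "half_size P = real j" by (simp add: half_size_def j)
    then show ?thesis using key[of j] by (simp add: j)
  qed
  show ?thesis
    unfolding Sigma_part_def using half kn by fastforce
qed

text \<open>With k = floor(un), the asymptotics leave the factors (k/n)^2 and (ln(2n) / ln(2k))^2.
  The first tends to u^2. The second tends to 1, since ln(2k/2n) tends to the finite value ln u
  while ln(2k) is unbounded, both because u > 0.\<close>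

lemma card_Sigma_part_ratio:
  assumes u: "0 < u" "u < 1"
  shows "(\<lambda>n. real (card (Sigma_part (2 * nat \<lfloor>u * real n\<rfloor>))) / real (card (Sigma_part (2 * n)))) \<longlonglongrightarrow> u\<^sup>2"
proof -
  let ?k = "\<lambda>n::nat. nat \<lfloor>u * real n\<rfloor>"
  let ?g = "\<lambda>m. real (card (Sigma_part m)) * (ln (real m))\<^sup>2 / (real m)\<^sup>2"
  have "filterlim (\<lambda>n. 2 * n) at_top (sequentially :: nat filter)"
    by (rule filterlim_subseq) (auto simp: strict_mono_def)
  then have g1: "(\<lambda>n. ?g (2 * n)) \<longlonglongrightarrow> 1 / 4"
    by (rule filterlim_compose[OF card_Sigma_part_asymptotic])
  have kreal: "filterlim (\<lambda>n. real (2 * ?k n)) at_top sequentially"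
  proof (rule filterlim_at_top_mono)
    show "filterlim (\<lambda>n. 2 * (u * real n - 1)) at_top sequentially" using u by real_asymp
    show "\<forall>\<^sub>F n in sequentially. 2 * (u * real n - 1) \<le> real (2 * ?k n)"
      by (rule always_eventually) (auto, linarith)
  qed
  then have "filterlim (\<lambda>n. 2 * ?k n) at_top sequentially"
    by (simp only: filterlim_sequentially_iff_filterlim_real)
  then have g2: "(\<lambda>n. ?g (2 * ?k n)) \<longlonglongrightarrow> 1 / 4"
    by (rule filterlim_compose[OF card_Sigma_part_asymptotic])
  have r: "(\<lambda>n. real (2 * ?k n) / real (2 * n)) \<longlonglongrightarrow> u"
  proof (rule tendsto_sandwich)
    show "(\<lambda>n. (u * real n - 1) / real n) \<longlonglongrightarrow> u" using u by real_asymp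
    show "(\<lambda>n. (u * real n) / real n) \<longlonglongrightarrow> u" using u by real_asymp
    show "\<forall>\<^sub>F n in sequentially. (u * real n - 1) / real n \<le> real (2 * ?k n) / real (2 * n)"
    proof (rule always_eventually, intro allI)
      fix n
      have "u * real n - 1 \<le> real (?k n)" by linarith
      then show "(u * real n - 1) / real n \<le> real (2 * ?k n) / real (2 * n)" by (simp add: divide_right_mono)
    qed
    show "\<forall>\<^sub>F n in sequentially. real (2 * ?k n) / real (2 * n) \<le> (u * real n) / real n"
    proof (rule always_eventually, intro allI)
      fix n
      have "real (?k n) / real n \<le> (u * real n) / real n" using u by (intro divide_right_mono) auto
      then show "real (2 * ?k n) / real (2 * n) \<le> (u * real n) / real n"
        unfolding of_nat_mult by (subst mult_divide_mult_cancel_left) auto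
    qed
  qed
  have l: "(\<lambda>n. ln (real (2 * n)) / ln (real (2 * ?k n))) \<longlonglongrightarrow> 1"
  proof -
    have "(\<lambda>n. ln (real (2 * ?k n) / real (2 * n))) \<longlonglongrightarrow> ln u"
      using u by (intro tendsto_ln r) auto
    moreover have lk: "filterlim (\<lambda>n. ln (real (2 * ?k n))) at_top sequentially"
      by (rule filterlim_compose[OF ln_at_top kreal])
    ultimately have "(\<lambda>n. ln (real (2 * ?k n) / real (2 * n)) / ln (real (2 * ?k n))) \<longlonglongrightarrow> 0"
      by (intro tendsto_divide_0) (auto intro: filterlim_at_top_imp_at_infinity)
    then have "(\<lambda>n. 1 - ln (real (2 * ?k n) / real (2 * n)) / ln (real (2 * ?k n))) \<longlonglongrightarrow> 1 - 0"
      by (intro tendsto_diff tendsto_const)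
    moreover have "\<forall>\<^sub>F n in sequentially. 1 - ln (real (2 * ?k n) / real (2 * n)) / ln (real (2 * ?k n)) = ln (real (2 * n)) / ln (real (2 * ?k n))"
      using eventually_gt_at_top[of 0] filterlim_at_top_dense[THEN iffD1, OF kreal, rule_format, of 1]
    proof eventually_elim
      case (elim n)
      have "ln (real (2 * ?k n)) > 0" using elim by (intro ln_gt_zero)
      moreover have "ln (real (2 * ?k n) / real (2 * n)) = ln (real (2 * ?k n)) - ln (real (2 * n))"
        using elim by (subst ln_div) auto
      ultimately show ?case by (simp only: diff_divide_distrib) simp
    qed
    ultimately have "(\<lambda>n. ln (real (2 * n)) / ln (real (2 * ?k n))) \<longlonglongrightarrow> 1 - 0"
      by (rule Lim_transform_eventually)
    then show ?thesis by simp
  qed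
  have "(\<lambda>n. ?g (2 * ?k n) / ?g (2 * n) * (real (2 * ?k n) / real (2 * n))\<^sup>2 * (ln (real (2 * n)) / ln (real (2 * ?k n)))\<^sup>2) \<longlonglongrightarrow> (1 / 4) / (1 / 4) * u\<^sup>2 * 1\<^sup>2"
    by (intro tendsto_mult tendsto_power tendsto_divide g1 g2 r l) auto
  moreover have "\<forall>\<^sub>F n in sequentially. ?g (2 * ?k n) / ?g (2 * n) * (real (2 * ?k n) / real (2 * n))\<^sup>2 * (ln (real (2 * n)) / ln (real (2 * ?k n)))\<^sup>2
      = real (card (Sigma_part (2 * ?k n))) / real (card (Sigma_part (2 * n)))"
    using eventually_gt_at_top[of 0] filterlim_at_top_dense[THEN iffD1, OF kreal, rule_format, of 1]
  proof eventually_elim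
    case (elim n)
    have alg: "(a * y\<^sup>2 / x\<^sup>2) / (b * w\<^sup>2 / z\<^sup>2) * (x / z)\<^sup>2 * (w / y)\<^sup>2 = a / b"
      if "x \<noteq> 0" "y \<noteq> 0" "z \<noteq> 0" "w \<noteq> 0" for a b x y z w :: real
      using that by (simp add: power_divide)
    have "ln (real (2 * ?k n)) > 0" using elim by (intro ln_gt_zero)
    moreover have "ln (real (2 * n)) > 0" using elim by (intro ln_gt_zero) linarith
    ultimately show ?case using elim by (intro alg) linarith+
  qed
  ultimately have "(\<lambda>n. real (card (Sigma_part (2 * ?k n))) / real (card (Sigma_part (2 * n)))) \<longlonglongrightarrow> (1 / 4) / (1 / 4) * u\<^sup>2 * 1\<^sup>2"
    by (rule Lim_transform_eventually)
  then show ?thesis by simp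
qed

theorem theorem2:
  fixes u :: real
  assumes "0 < u" and "u < 1"
  shows "(\<lambda>n::nat. measure_pmf.prob (pmf_of_set (Sigma_part (2 * n)))
            {P. half_size P / real n \<le> u}) \<longlonglongrightarrow> u\<^sup>2"
proof (rule Lim_transform_eventually[OF card_Sigma_part_ratio[OF assms]])
  show "\<forall>\<^sub>F n in sequentially. real (card (Sigma_part (2 * nat \<lfloor>u * real n\<rfloor>))) / real (card (Sigma_part (2 * n)))
      = measure_pmf.prob (pmf_of_set (Sigma_part (2 * n))) {P. half_size P / real n \<le> u}"
    \<comment> \<open>From n > 2 on the set is nonempty, so \<open>pmf_of_set\<close> is the uniform
      distribution and the probability is a quotient of cardinalities.\<close>
    using eventually_gt_at_top[of 2]
  proof eventually_elim
    case (elim n)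
    have "n > 0" using elim by simp
    then show ?case
      using Sigma_part_half_size_le[OF assms, of n]
      by (simp add: measure_pmf_of_set[OF Sigma_part_nonempty[OF elim] finite_Sigma_part])
  qed
qed

end
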